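(* Let $\lambda(t)=t|\log t|$. (a) Suppose that $f\in A^{-\infty}$ and $|f|$ is bounded from below on $\mathbf D$ by a positive constant. Then $G_+(f)$ is a countable union of sets each having finite $H_\lambda$ measure. (b) There exists $f\in A^{-\infty}$ such that $|f|$ is bounded from below by a positive constant and $H_\lambda(D_+(f))=\infty$.
   Context: $\mathbf D$ is the open unit disc, $\mathbf T$ the unit circle. $A^{-\infty}$ is the set of analytic functions $f$ in $\mathbf D$ with $|f(z)|\le C(1-|z|)^{-k}$ for some constants $C,k$. For $f\in A^{-\infty}$: $D_+(f)=\{\theta\in[0,2\pi):\ \liminf_{r\to1}\frac{\log|f(re^{i\theta})|}{|\log(1-r)|}>0\}$ and $G_+(f)=\{\theta\in[0,2\pi):\ \limsup_{r\to1}\frac{\log|f(re^{i\theta})|}{|\log(1-r)|}>0\}$, identified with subsets of $\mathbf T$. For increasing $\lambda$ with $\lambda(0)=0$, $H_\lambda(C)=\lim_{\epsilon\to0}\inf\{\sum_s\lambda(|J_s|): C\subset\bigcup_s J_s,\ |J_s|<\epsilon\}$ over coverings by arcs $J_s$ of $\mathbf T$. *)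

theory Defs
  imports "HOL-Analysis.Analysis" "HOL-Library.Liminf_Limsup"
begin

definition A_minus_infty :: "(complex \<Rightarrow> complex) set" where
  "A_minus_infty = {f. f holomorphic_on ball 0 1 \<and>
     (\<exists>C k::real. \<forall>z\<in>ball 0 1. norm (f z) \<le> C * (1 - norm z) powr (- k))}"

definition D_plus :: "(complex \<Rightarrow> complex) \<Rightarrow> complex set" where
  "D_plus f = {cis \<theta> | \<theta>. \<theta> \<in> {0..<2*pi} \<and>
     Liminf (at_left 1) (\<lambda>r::real. ereal (ln (norm (f (of_real r * cis \<theta>))) / \<bar>ln (1 - r)\<bar>)) > 0}"

definition G_plus :: "(complex \<Rightarrow> complex) \<Rightarrow> complex set" where
  "G_plus f = {cis \<theta> | \<theta>. \<theta> \<in> {0..<2*pi} \<and>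
     Limsup (at_left 1) (\<lambda>r::real. ereal (ln (norm (f (of_real r * cis \<theta>))) / \<bar>ln (1 - r)\<bar>)) > 0}"

definition lam :: "real \<Rightarrow> real" where
  "lam t = t * \<bar>ln t\<bar>"

text \<open>Hausdorff-type measure H_g with respect to countable coverings by closed arcs
  cis ` [a,b] of T of length b - a (length-0 arcs are points, so finite coverings are included).
  The limit as eps -> 0 of the (monotone in eps) infima is the supremum over eps > 0.\<close>
definition H_meas :: "(real \<Rightarrow> real) \<Rightarrow> complex set \<Rightarrow> ennreal" where
  "H_meas g C = (SUP \<epsilon>\<in>{0<..}. INF ab\<in>{ab :: (nat \<Rightarrow> real) \<times> (nat \<Rightarrow> real).
        (\<forall>n. 0 \<le> snd ab n - fst ab n \<and> snd ab n - fst ab n < \<epsilon>) \<and>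
        C \<subseteq> (\<Union>n. cis ` {fst ab n..snd ab n})}.
        (\<Sum>n. ennreal (g (snd ab n - fst ab n))))"

end

theory Submission
  imports Defs "HOL-Complex_Analysis.Complex_Analysis"
begin

text \<open>
  Dividing by the lower bound, \<open>ln \<bar>f\<bar>\<close> becomes a nonnegative harmonic function \<open>u = Re G\<close>
  with \<open>u z \<le> A (1 - ln (1 - \<bar>z\<bar>))\<close>; by the Poisson formula this growth bound says that the boundary
  masses of \<open>u\<close> on arcs of length \<open>h\<close> are \<open>O(\<lambda>(h))\<close>.

  (a) At a point at distance \<open>\<delta>\<close> from the circle, the mass outside the arc of radius \<open>2\<^sup>K \<delta>\<close>
  contributes only \<open>O(2\<^sup>-\<^sup>K \<bar>ln \<delta>\<bar>)\<close> to \<open>u\<close>. Hence if \<open>u > \<eta> \<bar>ln \<delta>\<bar>\<close> there, then for a large fixed \<open>K\<close>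
  that arc has mass at least \<open>c \<eta> \<lambda>(\<delta>)\<close>. Vitali's covering lemma selects disjoint arcs of this kind whose
  dilations cover, and the total mass \<open>u 0\<close> bounds the sum of their \<open>\<lambda>\<close>-lengths. To avoid constructing
  the representing measure, all masses are taken on circles of radius \<open>R < 1\<close>, and \<open>R\<close> is chosen close to 1
  only after a finite subfamily of arcs has been fixed.

  (b) The map \<open>X\<^sub>n x = (\<Sum>j\<ge>n. n / (j (j + 1)) \<lfloor>2\<^sup>j x\<rfloor> / 2\<^sup>j)\<close> pushes Lebesgue measure on the unit interval
  to a Cantor measure which is roughly uniform down to scale \<open>2\<^sup>-\<^sup>n\<close>, and whose arcs of length \<open>h\<close> centred in
  the support have mass comparable to \<open>\<lambda>(h) / n\<close> for all smaller scales. Its range therefore has \<open>\<lambda>\<close>-measure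
  at least of order \<open>n\<close>. The weighted sum \<open>F\<close> of the Herglotz transforms of these measures has
  \<open>Re F = O(1 - ln (1 - \<bar>z\<bar>))\<close>, and \<open>Re F\<close> grows like \<open>\<bar>ln (1 - r)\<bar>\<close> along every radius ending in the range
  of some \<open>X\<^sub>n\<close>, so \<open>f = exp F\<close> works.
\<close>

subsection \<open>Chords and arcs\<close>

text \<open>On the first part of the range the derivative \<open>cos y - 1/2\<close> is nonnegative.
  Beyond \<open>pi/3\<close> the sine is at least \<open>sqrt 3 / 2\<close>, which is at least 0.85,
  while \<open>x/2\<close> is at most \<open>pi/4\<close>, below 0.8.\<close>

lemma half_le_sin:
  fixes x :: real
  assumes "0 \<le> x" "x \<le> pi/2"
  shows "x/2 \<le> sin x"
proof (cases "x \<le> pi/3")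
  case True
  have "(\<lambda>y. sin y - y/2) 0 \<le> (\<lambda>y. sin y - y/2) x"
  proof (rule DERIV_nonneg_imp_nondecreasing[OF assms(1)])
    fix y :: real assume y: "0 \<le> y" "y \<le> x"
    have "cos y \<ge> 1/2"
      using cos_monotone_0_pi_le[of y "pi/3"] y True by (simp add: cos_60)
    thus "\<exists>d. ((\<lambda>y. sin y - y/2) has_real_derivative d) (at y) \<and> 0 \<le> d"
      by (intro exI[of _ "cos y - 1/2"]) (auto intro!: derivative_eq_intros)
  qed
  thus ?thesis by simp
next
  case False
  have "sin (pi/3) \<le> sin x"
    using False assms by (intro sin_monotone_2pi_le) auto
  moreover have "sin (pi/3) = sqrt 3/2" by (simp add: sin_60)
  moreover have "sqrt 3 \<ge> 1.7" by (rule real_le_rsqrt) (simp add: power2_eq_square)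
  moreover have "pi < 3.2" using pi_approx by simp
  ultimately show ?thesis using assms by linarith
qed

text \<open>The chord of angle \<open>t\<close> has length \<open>2 * \<bar>sin (t/2)\<bar>\<close>,
  so the sine bound costs only a factor 2. This is how planar distances are turned back into angles
  throughout.\<close>

lemma abs_le_chord:
  fixes t :: real
  assumes "\<bar>t\<bar> \<le> pi"
  shows "\<bar>t\<bar> \<le> 2 * norm (cis t - 1)"
proof -
  have "norm (cis t - 1) = 2 * \<bar>sin (t/2)\<bar>"
    using dist_exp_i_1[of t] by (simp add: cis_conv_exp)
  moreover have "\<bar>t\<bar>/2/2 \<le> sin (\<bar>t\<bar>/2)" using assms by (intro half_le_sin) auto
  moreover have "sin (\<bar>t\<bar>/2) \<le> \<bar>sin (t/2)\<bar>" by (cases "t \<ge> 0") auto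
  ultimately show ?thesis by linarith
qed

lemma chord_eq: "norm (cis a - cis b) = norm (cis (a - b) - 1)"
proof -
  have "cis a - cis b = cis b * (cis (a - b) - 1)"
    by (simp add: algebra_simps cis_mult)
  thus ?thesis by (simp add: norm_mult)
qed

lemma chord_le: "norm (cis a - cis b) \<le> \<bar>a - b\<bar>"
proof -
  have "norm (cis a - cis b) = 2 * \<bar>sin ((a-b)/2)\<bar>"
    unfolding chord_eq using dist_exp_i_1[of "a-b"] by (simp add: cis_conv_exp)
  thus ?thesis using abs_sin_x_le_abs_x[of "(a-b)/2"] by simp
qed

text \<open>Vitali's lemma produces balls in the plane, whereas \<open>H_meas\<close> counts arcs;
  this converts the former into the latter.\<close>

lemma cball_inter_circle_subset_arc:
  assumes "0 \<le> \<rho>"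
  shows "cball (cis a) \<rho> \<inter> range cis \<subseteq> cis ` {a - 2*\<rho>..a + 2*\<rho>}"
proof
  fix w assume w: "w \<in> cball (cis a) \<rho> \<inter> range cis"
  then obtain b where b: "w = cis b" by auto
  \<comment> \<open>Reduces \<open>b - a\<close> modulo \<open>2*pi\<close> to the range where the
    chord bound is valid.\<close>
  define t where "t = Arg (cis (b - a))"
  have t: "cis t = cis (b - a)" "\<bar>t\<bar> \<le> pi"
    using cis_Arg_unique Arg_bounded[of "cis (b-a)"] by (auto simp: t_def cis_Arg abs_le_iff)
  have "norm (cis t - 1) \<le> \<rho>"
    using w by (simp add: b t chord_eq[of b a, symmetric] dist_norm norm_minus_commute[of "cis a"])
  hence "\<bar>t\<bar> \<le> 2*\<rho>" using abs_le_chord[OF t(2)] by linarith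
  moreover have "cis (a + t) = w" by (simp add: cis_mult[symmetric] t b) (simp add: cis_mult)
  ultimately show "w \<in> cis ` {a - 2*\<rho>..a + 2*\<rho>}"
    by (intro image_eqI[of _ _ "a+t"]) (auto simp: abs_le_iff)
qed

subsection \<open>Poisson kernel estimates\<close>

text \<open>On the shell where \<open>g\<close> lies between \<open>2^k * \<delta>\<close> and
  \<open>2^(k+1) * \<delta>\<close> the integrand is at most
  \<open>1 / (2^k * \<delta>)\<^sup>2\<close>, while the mass is linear in
  \<open>2^k * \<delta>\<close>; the shells beyond \<open>K\<close> therefore sum geometrically. The
  mass inside radius \<open>2^K * \<delta>\<close> is deliberately left unestimated: with
  \<open>K\<close> large it is the quantity to be bounded from below in (a), and with
  \<open>K = 0\<close> the lemma is a plain upper bound in (b).\<close>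

lemma nn_integral_inverse_square_dyadic:
  fixes g :: "'a \<Rightarrow> real"
  assumes [measurable]: "g \<in> borel_measurable M" and \<delta>: "0 < \<delta>" and B: "0 \<le> B"
    and g: "\<And>x. x \<in> space M \<Longrightarrow> \<delta> \<le> g x"
    and meas: "\<And>k. k \<ge> K \<Longrightarrow>
      emeasure M {x \<in> space M. g x \<le> 2 ^ Suc k * \<delta>} \<le> ennreal (B * 2 ^ k * \<delta>)"
  shows "(\<integral>\<^sup>+x. ennreal (1 / (g x)\<^sup>2) \<partial>M)
    \<le> ennreal (1 / \<delta>\<^sup>2) * emeasure M {x \<in> space M. g x \<le> 2 ^ K * \<delta>} + ennreal (2 * B / (2 ^ K * \<delta>))"
proof -
  define E where "E k = {x \<in> space M. g x \<le> 2 ^ k * \<delta>}" for k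
  have [measurable]: "E k \<in> sets M" for k unfolding E_def by measurable
  define a where "a i = 1 / (2 ^ (K + i) * \<delta>)\<^sup>2" for i
  have a: "0 \<le> a i" for i by (simp add: a_def)
  have pt: "ennreal (1 / (g x)\<^sup>2) \<le> ennreal (1 / \<delta>\<^sup>2) * indicator (E K) x
      + (\<Sum>i. ennreal (a i) * indicator (E (Suc (K + i))) x)" if x: "x \<in> space M" for x
  proof (cases "x \<in> E K")
    case True
    have "1 / (g x)\<^sup>2 \<le> 1 / \<delta>\<^sup>2"
      using g[OF x] \<delta> by (intro divide_left_mono power_mono) (auto simp: less_le_trans)
    hence "ennreal (1 / (g x)\<^sup>2) \<le> ennreal (1 / \<delta>\<^sup>2)" by (rule ennreal_leI)
    with True show ?thesis by (simp add: add_increasing2)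
  next
    case False
    have "\<exists>k. g x \<le> 2 ^ k * \<delta>"
    proof -
      obtain k where "g x / \<delta> < 2 ^ k" using real_arch_pow[of 2 "g x / \<delta>"] by auto
      thus ?thesis using \<delta> by (intro exI[of _ k]) (simp add: field_simps)
    qed
    \<comment> \<open>The least such \<open>k\<close> names the shell of \<open>x\<close>: failure
      at \<open>k - 1\<close> is the lower bound on \<open>g x\<close> needed for the coefficient
      \<open>a i\<close>.\<close>
    define k where "k = (LEAST k. g x \<le> 2 ^ k * \<delta>)"
    have k: "g x \<le> 2 ^ k * \<delta>" unfolding k_def by (rule LeastI_ex) fact
    have "K < k"
    proof (rule ccontr)
      assume "\<not> K < k"
      hence "(2::real) ^ k * \<delta> \<le> 2 ^ K * \<delta>" using \<delta> by (intro mult_right_mono power_increasing) auto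
      with k False x show False by (auto simp: E_def)
    qed
    then obtain i where i: "k = Suc (K + i)" using less_imp_Suc_add by blast
    have "\<not> g x \<le> 2 ^ (K + i) * \<delta>"
      using not_less_Least[of "K+i" "\<lambda>k. g x \<le> 2 ^ k * \<delta>"] by (simp add: k_def[symmetric] i)
    hence "1 / (g x)\<^sup>2 \<le> a i" unfolding a_def using \<delta>
      less_le_trans[OF \<delta> g[OF x]] by (intro divide_left_mono power_mono) (auto intro!: mult_pos_pos zero_less_power simp: not_le)
    hence "ennreal (1 / (g x)\<^sup>2) \<le> ennreal (a i) * indicator (E (Suc (K+i))) x"
      using k x by (simp add: E_def i ennreal_leI)
    also have "\<dots> \<le> (\<Sum>i. ennreal (a i) * indicator (E (Suc (K + i))) x)"
      using sum_le_suminf[of "\<lambda>i. ennreal (a i) * indicator (E (Suc (K + i))) x" "{i}"]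
      by (simp only: sum.insert sum.empty finite.emptyI finite.insertI) (simp del: sum_mult_indicator)
    finally show ?thesis by (simp add: add_increasing)
  qed
  have s: "(\<lambda>i. B / (2 ^ (K + i) * \<delta>)) sums (2 * B / (2 ^ K * \<delta>))"
    using sums_mult[OF geometric_sums[of "1/2::real"], of "B / (2 ^ K * \<delta>)"]
    by (simp add: power_add field_simps)
  have "(\<integral>\<^sup>+x. ennreal (1 / (g x)\<^sup>2) \<partial>M) \<le>
      (\<integral>\<^sup>+x. ennreal (1 / \<delta>\<^sup>2) * indicator (E K) x
      + (\<Sum>i. ennreal (a i) * indicator (E (Suc (K + i))) x) \<partial>M)"
    by (intro nn_integral_mono pt)
  also have "\<dots> = ennreal (1 / \<delta>\<^sup>2) * emeasure M (E K) + (\<Sum>i. ennreal (a i) * emeasure M (E (Suc (K + i))))"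
    by (simp add: nn_integral_add nn_integral_suminf nn_integral_cmult)
  also have "(\<Sum>i. ennreal (a i) * emeasure M (E (Suc (K + i)))) \<le> (\<Sum>i. ennreal (B / (2 ^ (K + i) * \<delta>)))"
  proof (intro suminf_le allI)
    fix i
    have "ennreal (a i) * emeasure M (E (Suc (K + i))) \<le> ennreal (a i) * ennreal (B * 2 ^ (K + i) * \<delta>)"
      unfolding E_def by (intro mult_left_mono meas) auto
    also have "\<dots> = ennreal (a i * (B * 2 ^ (K + i) * \<delta>))"
      using a B \<delta> by (simp add: ennreal_mult)
    also have "a i * (B * 2 ^ (K + i) * \<delta>) = B / (2 ^ (K + i) * \<delta>)"
      using \<delta> by (simp add: a_def field_simps power2_eq_square)
    finally show "ennreal (a i) * emeasure M (E (Suc (K + i))) \<le> ennreal (B / (2 ^ (K + i) * \<delta>))" .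
  qed auto
  also have "(\<Sum>i. ennreal (B / (2 ^ (K + i) * \<delta>))) = ennreal (2 * B / (2 ^ K * \<delta>))"
    using s B \<delta> by (subst suminf_ennreal2) (auto simp: sums_iff)
  finally show ?thesis by (simp add: E_def add_left_mono)
qed

lemma poisson_integral_formula:
  assumes F: "F holomorphic_on cball 0 1" and z: "norm z < 1"
  shows "((\<lambda>t. (1 - (norm z)\<^sup>2) / (norm (cis (2*pi*t) - z))\<^sup>2 * Re (F (cis (2*pi*t)))) has_integral Re (F z)) {0..1}"
proof -
  \<comment> \<open>On the unit circle \<open>w / (1 - cnj z * w) = 1 / cnj (w - z)\<close>, which turns the Cauchy kernel of \<open>G\<close>
    into the Poisson kernel, while \<open>G z = F z\<close>.\<close>
  define G where "G w = F w * (of_real (1 - (norm z)\<^sup>2) / (1 - cnj z * w))" for w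
  have nz: "1 - cnj z * w \<noteq> 0" if "norm w \<le> 1" for w
  proof
    assume "1 - cnj z * w = 0"
    hence "norm z * norm w = 1" by (metis complex_mod_cnj eq_iff_diff_eq_0 norm_mult norm_one)
    moreover have "norm z * norm w \<le> norm z * 1" using that by (intro mult_left_mono) auto
    ultimately show False using z by linarith
  qed
  have "G holomorphic_on cball 0 1"
    unfolding G_def using nz by (intro holomorphic_intros F) auto
  from Cauchy_integral_circlepath_simple[OF this, of z] z
  have "((\<lambda>u. G u / (u - z)) has_contour_integral 2 * of_real pi * \<i> * G z) (circlepath 0 1)" by simp
  moreover have "G z = F z"
    using nz[of z] z complex_norm_square[of z] by (simp add: G_def mult.commute)
  ultimately have I: "((\<lambda>t. G (cis (2*pi*t)) / (cis (2*pi*t) - z) * (2 * of_real pi * \<i> * cis (2*pi*t))) has_integral 2 * of_real pi * \<i> * F z) {0..1}"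
    unfolding has_contour_integral vector_derivative_circlepath
    by (simp add: circlepath_def linepath_def cis_conv_exp part_circlepath_def field_simps)
  have "((\<lambda>t. Re (G (cis (2*pi*t)) / (cis (2*pi*t) - z) * (2 * of_real pi * \<i> * cis (2*pi*t)) * (1/(2 * of_real pi * \<i>)))) has_integral
     Re (2 * of_real pi * \<i> * F z * (1/(2 * of_real pi * \<i>)))) {0..1}"
    using has_integral_Re[OF has_integral_mult_left[OF I]] .
  moreover have "Re (G (cis (2*pi*t)) / (cis (2*pi*t) - z) * (2 * of_real pi * \<i> * cis (2*pi*t)) * (1/(2 * of_real pi * \<i>)))
     = (1 - (norm z)\<^sup>2) / (norm (cis (2*pi*t) - z))\<^sup>2 * Re (F (cis (2*pi*t)))" for t
  proof -
    define w where "w = cis (2*pi*t)"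
    have w: "norm w = 1" "w * cnj w = 1" by (auto simp: w_def cis_cnj cis_mult)
    have cancel: "a * b * w / (w * c) = b / c * a" for a b c
      using w(1) by (cases "c = 0") (auto simp: field_simps)
    have "(1 - cnj z * w) = w * cnj (w - z)" using w by (simp add: algebra_simps)
    hence "G w / (w - z) * w = F w * of_real (1 - (norm z)\<^sup>2) * w / (w * (cnj (w - z) * (w - z)))"
      by (simp add: G_def)
    also have "cnj (w - z) * (w - z) = of_real ((norm (w - z))\<^sup>2)"
      by (metis complex_norm_square mult.commute of_real_power)
    also have "F w * of_real (1 - (norm z)\<^sup>2) * w / (w * of_real ((norm (w - z))\<^sup>2)) = of_real ((1 - (norm z)\<^sup>2) / (norm (w - z))\<^sup>2) * F w"
      using cancel by simp
    finally have "G w / (w - z) * w = of_real ((1 - (norm z)\<^sup>2) / (norm (w - z))\<^sup>2) * F w" .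
    moreover have "G w / (w - z) * (2 * of_real pi * \<i> * w) * (1/(2 * of_real pi * \<i>)) = G w / (w - z) * w"
      by (simp add: field_simps)
    ultimately show ?thesis unfolding w_def[symmetric] by (simp del: of_real_divide)
  qed
  ultimately show ?thesis by simp
qed

text \<open>The measure \<open>Re F\<close> times normalised arc length, carried by the parameter
  \<open>t\<close> of \<open>cis (2*pi*t)\<close> rather than by the circle. Since
  \<open>ennreal\<close> cuts negative values to 0, it has this meaning only when
  \<open>Re F\<close> is nonnegative on the circle. It will be applied to dilates
  \<open>G (R * z)\<close> with \<open>R < 1\<close>.\<close>

definition boundary_measure :: "(complex \<Rightarrow> complex) \<Rightarrow> real measure" where
  "boundary_measure F = density lborel (\<lambda>t. ennreal (Re (F (cis (2*pi*t)))) * indicator {0..1} t)"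

lemma space_boundary_measure [simp]: "space (boundary_measure F) = UNIV"
  and sets_boundary_measure [measurable_cong, simp]: "sets (boundary_measure F) = sets borel"
  by (simp_all add: boundary_measure_def)

lemma continuous_on_cis [continuous_intros]:
  "continuous_on S f \<Longrightarrow> continuous_on S (\<lambda>x. cis (f x))"
  unfolding cis_conv_exp by (intro continuous_intros)

lemma measurable_cis [measurable]: "cis \<in> borel_measurable borel"
  by (intro borel_measurable_continuous_onI continuous_intros)

text \<open>The Poisson formula divided by the constant \<open>1 - (norm z)\<^sup>2\<close>. As a
  nonnegative integral against a measure it can be estimated by monotonicity on pieces, without
  integrability side conditions.\<close>

lemma nn_integral_poisson:
  assumes F: "F holomorphic_on cball 0 1" and nonneg: "\<And>w. norm w = 1 \<Longrightarrow> 0 \<le> Re (F w)"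
    and z: "norm z < 1"
  shows "(\<integral>\<^sup>+t. ennreal (1 / (norm (cis (2*pi*t) - z))\<^sup>2) \<partial>boundary_measure F)
           = ennreal (Re (F z) / (1 - (norm z)\<^sup>2))"
proof -
  have c: "continuous_on UNIV (\<lambda>t. Re (F (cis (2*pi*t))))"
    by (intro continuous_intros continuous_on_compose2[OF holomorphic_on_imp_continuous_on[OF F]]) auto
  have [measurable]: "(\<lambda>t. Re (F (cis (2*pi*t)))) \<in> borel_measurable borel"
    by (rule borel_measurable_continuous_onI[OF c])
  have p: "1 - (norm z)\<^sup>2 > 0" using z by (simp add: power_less_one_iff)
  have "((\<lambda>t. 1 / (1 - (norm z)\<^sup>2) * ((1 - (norm z)\<^sup>2) / (norm (cis (2*pi*t) - z))\<^sup>2 * Re (F (cis (2*pi*t))))) has_integral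
     1 / (1 - (norm z)\<^sup>2) * Re (F z)) {0..1}"
    by (intro has_integral_mult_right poisson_integral_formula F z)
  hence I: "((\<lambda>t. Re (F (cis (2*pi*t))) * (1 / (norm (cis (2*pi*t) - z))\<^sup>2)) has_integral Re (F z) / (1 - (norm z)\<^sup>2)) {0..1}"
    using p by (simp add: mult.commute)
  have "(\<integral>\<^sup>+t. ennreal (1 / (norm (cis (2*pi*t) - z))\<^sup>2) \<partial>boundary_measure F) =
     (\<integral>\<^sup>+t. ennreal (Re (F (cis (2*pi*t))) * (1 / (norm (cis (2*pi*t) - z))\<^sup>2)) * indicator {0..1} t \<partial>lborel)"
    unfolding boundary_measure_def
  proof (subst nn_integral_density)
    have "ennreal (Re (F (cis (2*pi*t)))) * indicator {0..1} t * ennreal (1 / (norm (cis (2*pi*t) - z))\<^sup>2)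
      = ennreal (Re (F (cis (2*pi*t))) * (1 / (norm (cis (2*pi*t) - z))\<^sup>2)) * indicator {0..1} t" for t
      by (subst ennreal_mult) (auto simp: nonneg mult_ac)
    thus "(\<integral>\<^sup>+t. ennreal (Re (F (cis (2*pi*t)))) * indicator {0..1} t * ennreal (1 / (norm (cis (2*pi*t) - z))\<^sup>2) \<partial>lborel)
      = (\<integral>\<^sup>+t. ennreal (Re (F (cis (2*pi*t))) * (1 / (norm (cis (2*pi*t) - z))\<^sup>2)) * indicator {0..1} t \<partial>lborel)"
      by simp
  qed measurable
  also have "\<dots> = ennreal (Re (F z) / (1 - (norm z)\<^sup>2))"
    by (rule nn_integral_has_integral_lebesgue'[OF _ I]) (simp add: nonneg)
  finally show ?thesis .
qed

text \<open>The mean value property: at the centre the kernel is identically 1.\<close>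

lemma boundary_measure_total:
  assumes "F holomorphic_on cball 0 1" "\<And>w. norm w = 1 \<Longrightarrow> 0 \<le> Re (F w)"
  shows "emeasure (boundary_measure F) UNIV = ennreal (Re (F 0))"
  using nn_integral_poisson[OF assms, of 0] by (simp del: nn_integral_const) simp

text \<open>Seen from \<open>z = (1 - h) * w\<close>, all points of the circle within
  \<open>h\<close> of \<open>w\<close> are at distance at most \<open>2 * h\<close>, so there the
  inverse square kernel is at least \<open>1 / (4 * h\<^sup>2)\<close>. Together with
  \<open>h \<le> 1 - (norm z)\<^sup>2\<close> this bounds the mass by the value of
  \<open>Re F\<close> at one point.\<close>

lemma boundary_measure_disc_le:
  assumes F: "F holomorphic_on cball 0 1" and nonneg: "\<And>w. norm w = 1 \<Longrightarrow> 0 \<le> Re (F w)"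
    and h: "0 < h" "h \<le> 1" and w: "norm w = 1"
  shows "emeasure (boundary_measure F) {t. norm (cis (2*pi*t) - w) \<le> h} \<le> ennreal (4 * h * Re (F (of_real (1 - h) * w)))"
proof -
  define z where "z = of_real (1 - h) * w"
  have nz: "norm z = 1 - h" using h w by (simp add: z_def norm_mult del: of_real_diff)
  have q: "h \<le> 1 - (norm z)\<^sup>2" using h mult_left_mono[of h 1 h] by (simp add: nz power2_eq_square algebra_simps)
  \<comment> \<open>Nonnegativity is assumed only on the circle, so it is carried inside by the
    Poisson integral.\<close>
  have pos: "0 \<le> Re (F z)"
  proof -
    have "0 \<le> integral {0..1} (\<lambda>t. (1 - (norm z)\<^sup>2) / (norm (cis (2*pi*t) - z))\<^sup>2 * Re (F (cis (2*pi*t))))"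
      using h q by (intro integral_nonneg has_integral_integrable[OF poisson_integral_formula] F) (auto simp: nz nonneg)
    also have "\<dots> = Re (F z)" using h by (intro integral_unique poisson_integral_formula F) (simp add: nz)
    finally show ?thesis .
  qed
  have "emeasure (boundary_measure F) {t. norm (cis (2*pi*t) - w) \<le> h} =
    (\<integral>\<^sup>+t. indicator {t. norm (cis (2*pi*t) - w) \<le> h} t \<partial>boundary_measure F)" by simp
  also have "\<dots> \<le> (\<integral>\<^sup>+t. ennreal (4 * h\<^sup>2) * ennreal (1 / (norm (cis (2*pi*t) - z))\<^sup>2) \<partial>boundary_measure F)"
  proof (rule nn_integral_mono)
    fix t
    show "(indicator {t. norm (cis (2*pi*t) - w) \<le> h} t :: ennreal) \<le> ennreal (4 * h\<^sup>2) * ennreal (1 / (norm (cis (2*pi*t) - z))\<^sup>2)"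
    proof (cases "norm (cis (2*pi*t) - w) \<le> h")
      case True
      define g where "g = norm (cis (2*pi*t) - z)"
      have "w - z = of_real h * w" by (simp add: z_def algebra_simps)
      hence "norm (w - z) = h" using h w by (simp add: norm_mult)
      hence "g \<le> 2 * h" unfolding g_def using True norm_triangle_ineq[of "cis (2*pi*t) - w" "w - z"] by simp
      moreover have "norm (cis (2*pi*t)) - norm z \<le> g" unfolding g_def by (rule norm_triangle_ineq2)
      hence "g \<ge> h" by (simp add: nz)
      ultimately have "g\<^sup>2 \<le> (2 * h)\<^sup>2" "0 < g" using h power_mono[of g "2 * h" 2] by auto
      hence "1 \<le> 4 * h\<^sup>2 * (1 / g\<^sup>2)" by (simp add: field_simps)
      hence "ennreal 1 \<le> ennreal (4 * h\<^sup>2 * (1 / g\<^sup>2))" by (rule ennreal_leI)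
      also have "\<dots> = ennreal (4 * h\<^sup>2) * ennreal (1 / g\<^sup>2)" by (rule ennreal_mult) auto
      finally show ?thesis using True by (simp add: g_def)
    qed simp
  qed
  also have "\<dots> = ennreal (4 * h\<^sup>2) * ennreal (Re (F z) / (1 - (norm z)\<^sup>2))"
    using h by (subst nn_integral_cmult) (auto simp: nn_integral_poisson F nonneg nz)
  also have "\<dots> = ennreal (4 * h\<^sup>2 * (Re (F z) / (1 - (norm z)\<^sup>2)))"
    using pos h q by (intro ennreal_mult[symmetric]) auto
  also have "\<dots> \<le> ennreal (4 * h * Re (F z))"
  proof (rule ennreal_leI)
    have "Re (F z) / (1 - (norm z)\<^sup>2) \<le> Re (F z) / h" using q h pos by (intro divide_left_mono) auto
    hence "4 * h\<^sup>2 * (Re (F z) / (1 - (norm z)\<^sup>2)) \<le> 4 * h\<^sup>2 * (Re (F z) / h)" by (intro mult_left_mono) auto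
    thus "4 * h\<^sup>2 * (Re (F z) / (1 - (norm z)\<^sup>2)) \<le> 4 * h * Re (F z)" using h by (simp add: power2_eq_square)
  qed
  finally show ?thesis by (simp add: z_def)
qed

text \<open>The growth bound gives mass \<open>O(h * L)\<close> to every disc of radius
  \<open>h \<ge> \<delta>\<close> about \<open>w\<close>, with \<open>L = 1 - ln \<delta>\<close>.
  The dyadic estimate then leaves only \<open>O(L / 2^K)\<close> for the mass far from
  \<open>w\<close>, so a large value of \<open>Re F\<close> must come from nearby mass.\<close>

lemma re_le_local_boundary_mass:
  assumes F: "F holomorphic_on cball 0 1" and nonneg: "\<And>w. norm w \<le> 1 \<Longrightarrow> 0 \<le> Re (F w)"
    and growth: "\<And>w. norm w < 1 \<Longrightarrow> Re (F w) \<le> A * (1 - ln (1 - norm w))"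
    and \<delta>: "0 < \<delta>" "\<delta> < 1" and w: "norm w = 1"
  shows "ennreal (Re (F (of_real (1 - \<delta>) * w))) \<le>
     ennreal (2 / \<delta>) * emeasure (boundary_measure F) {t. norm (cis (2*pi*t) - w) \<le> 2 ^ Suc K * \<delta>}
     + ennreal (64 * A * (1 - ln \<delta>) / 2 ^ K)"
proof -
  define z where "z = of_real (1 - \<delta>) * w"
  define M where "M = boundary_measure F"
  define L where "L = 1 - ln \<delta>"
  have L: "1 \<le> L" using \<delta> by (simp add: L_def)
  have A: "0 \<le> Re (F 0)" "Re (F 0) \<le> A" using nonneg[of 0] growth[of 0] by auto
  have nz: "norm z = 1 - \<delta>" using \<delta> w by (simp add: z_def norm_mult del: of_real_diff)
  have "w - z = of_real \<delta> * w" by (simp add: z_def algebra_simps)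
  hence wz: "norm (w - z) = \<delta>" using \<delta> w by (simp add: norm_mult)
  \<comment> \<open>The kernel is centred at \<open>z\<close>, the masses at \<open>w\<close>. The
    shift by \<open>norm (w - z) = \<delta>\<close> is absorbed by doubling the radius, whence
    \<open>Suc K\<close> in the conclusion.\<close>
  have sub: "{t. norm (cis (2*pi*t) - z) \<le> 2 ^ k * \<delta>} \<subseteq> {t. norm (cis (2*pi*t) - w) \<le> 2 ^ Suc k * \<delta>}" for k
  proof clarify
    fix t assume "norm (cis (2*pi*t) - z) \<le> 2 ^ k * \<delta>"
    moreover have "norm (cis (2*pi*t) - w) \<le> norm (cis (2*pi*t) - z) + \<delta>"
      using norm_triangle_ineq[of "cis (2*pi*t) - z" "z - w"] wz by (simp add: norm_minus_commute)
    moreover have "\<delta> \<le> 2 ^ k * \<delta>" using \<delta> by simp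
    ultimately show "norm (cis (2*pi*t) - w) \<le> 2 ^ Suc k * \<delta>" by simp
  qed
  have mass: "emeasure M {t. norm (cis (2*pi*t) - w) \<le> h} \<le> ennreal (4 * h * A * L)" if "\<delta> \<le> h" for h
  proof (cases "h \<le> 1")
    case True
    have "Re (F (of_real (1 - h) * w)) \<le> A * (1 - ln h)"
      using growth[of "of_real (1 - h) * w"] True that \<delta> w by (simp add: norm_mult del: of_real_diff)
    also have "\<dots> \<le> A * L" unfolding L_def using that \<delta> A by (intro mult_left_mono) auto
    finally have "4 * h * Re (F (of_real (1 - h) * w)) \<le> 4 * h * (A * L)" using that \<delta> by (intro mult_left_mono) auto
    moreover have "emeasure M {t. norm (cis (2*pi*t) - w) \<le> h} \<le> ennreal (4 * h * Re (F (of_real (1 - h) * w)))"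
      unfolding M_def using that \<delta> True by (intro boundary_measure_disc_le F nonneg w) auto
    ultimately show ?thesis by (simp add: ennreal_leI order_trans mult.assoc)
  next
    \<comment> \<open>For \<open>h > 1\<close> there is no test point at depth \<open>h\<close>; the
      total mass \<open>Re (F 0) \<le> A\<close> is small enough.\<close>
    case False
    have "emeasure M {t. norm (cis (2*pi*t) - w) \<le> h} \<le> emeasure M UNIV" by (intro emeasure_mono) (auto simp: M_def)
    also have "\<dots> = ennreal (Re (F 0))" unfolding M_def by (intro boundary_measure_total F nonneg) auto
    also have "\<dots> \<le> ennreal (4 * h * A * L)"
    proof (rule ennreal_leI)
      have "A * 1 \<le> A * (4 * h * L)" using A False L mult_mono[of 1 "4*h" 1 L] by (intro mult_left_mono) auto
      thus "Re (F 0) \<le> 4 * h * A * L" using A by (simp add: mult_ac)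
    qed
    finally show ?thesis .
  qed
  have int: "(\<integral>\<^sup>+t. ennreal (1 / (norm (cis (2*pi*t) - z))\<^sup>2) \<partial>M)
    \<le> ennreal (1 / \<delta>\<^sup>2) * emeasure M {t \<in> space M. norm (cis (2*pi*t) - z) \<le> 2 ^ K * \<delta>} + ennreal (2 * (16 * A * L) / (2 ^ K * \<delta>))"
  proof (rule nn_integral_inverse_square_dyadic)
    show "(\<lambda>t. norm (cis (2*pi*t) - z)) \<in> borel_measurable M" unfolding M_def by measurable
    show "0 \<le> 16 * A * L" using A L by simp
    show "\<delta> \<le> norm (cis (2*pi*t) - z)" for t
      using norm_triangle_ineq2[of "cis (2*pi*t)" z] by (simp add: nz)
    fix k
    have "emeasure M {t \<in> space M. norm (cis (2*pi*t) - z) \<le> 2 ^ Suc k * \<delta>}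
       \<le> emeasure M {t. norm (cis (2*pi*t) - w) \<le> 2 ^ Suc (Suc k) * \<delta>}"
      using sub[of "Suc k"] unfolding M_def by (intro emeasure_mono) auto
    also have "\<dots> \<le> ennreal (4 * (2 ^ Suc (Suc k) * \<delta>) * A * L)"
    proof (rule mass)
      have "1 * \<delta> \<le> 2 ^ Suc (Suc k) * \<delta>" using \<delta> by (intro mult_right_mono one_le_power) auto
      thus "\<delta> \<le> 2 ^ Suc (Suc k) * \<delta>" by simp
    qed
    \<comment> \<open>One doubling comes from the dyadic lemma and one from the shift of centre,
      which gives the constant \<open>16 * A * L\<close>.\<close>
    also have "4 * (2 ^ Suc (Suc k) * \<delta>) * A * L = 16 * A * L * 2 ^ k * \<delta>" by simp
    finally show "emeasure M {t \<in> space M. norm (cis (2*pi*t) - z) \<le> 2 ^ Suc k * \<delta>} \<le> ennreal (16 * A * L * 2 ^ k * \<delta>)" .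
  qed (use \<delta> in auto)
  have q: "0 < 1 - (norm z)\<^sup>2" "1 - (norm z)\<^sup>2 \<le> 2 * \<delta>"
    using \<delta> mult_strict_left_mono[of \<delta> 1 \<delta>] by (auto simp: nz power2_eq_square algebra_simps)
  have "ennreal (Re (F z)) \<le> ennreal (2 * \<delta>) * ennreal (Re (F z) / (1 - (norm z)\<^sup>2))"
  proof -
    have p: "0 \<le> Re (F z)" using nonneg[of z] nz \<delta> by simp
    have "Re (F z) = (1 - (norm z)\<^sup>2) * (Re (F z) / (1 - (norm z)\<^sup>2))" using q by simp
    also have "\<dots> \<le> 2 * \<delta> * (Re (F z) / (1 - (norm z)\<^sup>2))" using p q by (intro mult_right_mono) auto
    finally show ?thesis using p q \<delta> by (subst ennreal_mult[symmetric]) (auto intro: ennreal_leI)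
  qed
  also have "\<dots> = ennreal (2 * \<delta>) * (\<integral>\<^sup>+t. ennreal (1 / (norm (cis (2*pi*t) - z))\<^sup>2) \<partial>M)"
    unfolding M_def using \<delta> by (subst nn_integral_poisson[OF F]) (auto simp: nonneg nz)
  also have "\<dots> \<le> ennreal (2 * \<delta>) * (ennreal (1 / \<delta>\<^sup>2) * emeasure M {t \<in> space M. norm (cis (2*pi*t) - z) \<le> 2 ^ K * \<delta>}
       + ennreal (2 * (16 * A * L) / (2 ^ K * \<delta>)))"
    by (intro mult_left_mono int) simp
  also have "\<dots> = ennreal (2 * \<delta> * (1 / \<delta>\<^sup>2)) * emeasure M {t \<in> space M. norm (cis (2*pi*t) - z) \<le> 2 ^ K * \<delta>}
       + ennreal (2 * \<delta> * (2 * (16 * A * L) / (2 ^ K * \<delta>)))"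
  proof -
    have 1: "ennreal (2 * \<delta>) * ennreal (1 / \<delta>\<^sup>2) = ennreal (2 * \<delta> * (1 / \<delta>\<^sup>2))"
      using \<delta> by (intro ennreal_mult[symmetric]) auto
    have 2: "ennreal (2 * \<delta>) * ennreal (2 * (16 * A * L) / (2 ^ K * \<delta>)) = ennreal (2 * \<delta> * (2 * (16 * A * L) / (2 ^ K * \<delta>)))"
      using \<delta> A L by (intro ennreal_mult[symmetric]) auto
    show ?thesis by (simp only: distrib_left mult.assoc[symmetric] 1 2[unfolded mult.assoc[symmetric]])
  qed
  also have "2 * \<delta> * (1 / \<delta>\<^sup>2) = 2 / \<delta>" using \<delta> by (simp add: power2_eq_square)
  also have "2 * \<delta> * (2 * (16 * A * L) / (2 ^ K * \<delta>)) = 64 * A * L / 2 ^ K" using \<delta> by simp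
  also have "emeasure M {t \<in> space M. norm (cis (2*pi*t) - z) \<le> 2 ^ K * \<delta>} \<le> emeasure M {t. norm (cis (2*pi*t) - w) \<le> 2 ^ Suc K * \<delta>}"
    using sub[of K] unfolding M_def by (intro emeasure_mono) auto
  finally show ?thesis by (simp add: z_def L_def M_def mult_left_mono add_right_mono)
qed

subsection \<open>Vitali covering of the points of large growth\<close>

text \<open>Adapts the definition to covers indexed by any countable set. Only finite partial sums
  have to be bounded, which is what makes it possible to choose the circle of radius
  \<open>R\<close> after a finite subfamily is known.\<close>

lemma H_meas_le_countable:
  fixes l u :: "real \<Rightarrow> 'a \<Rightarrow> real"
  assumes g: "g 0 = 0"
    and C: "\<And>\<epsilon>. \<epsilon> > 0 \<Longrightarrow> countable (C \<epsilon>)"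
    and arcs: "\<And>\<epsilon> i. \<epsilon> > 0 \<Longrightarrow> i \<in> C \<epsilon> \<Longrightarrow> 0 \<le> u \<epsilon> i - l \<epsilon> i \<and> u \<epsilon> i - l \<epsilon> i < \<epsilon>"
    and cover: "\<And>\<epsilon>. \<epsilon> > 0 \<Longrightarrow> S \<subseteq> (\<Union>i\<in>C \<epsilon>. cis ` {l \<epsilon> i..u \<epsilon> i})"
    and sum: "\<And>\<epsilon> J. \<epsilon> > 0 \<Longrightarrow> finite J \<Longrightarrow> J \<subseteq> C \<epsilon> \<Longrightarrow> (\<Sum>i\<in>J. ennreal (g (u \<epsilon> i - l \<epsilon> i))) \<le> B"
  shows "H_meas g S \<le> B"
  unfolding H_meas_def
proof (rule SUP_least)
  fix \<epsilon> :: real assume "\<epsilon> \<in> {0<..}"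
  hence e: "\<epsilon> > 0" by simp
  note C = C[OF e] and arcs = arcs[OF e] and cover = cover[OF e] and sum = sum[OF e]
  define I where "I = to_nat_on (C \<epsilon>) ` C \<epsilon>"
  define i where "i = from_nat_into (C \<epsilon>)"
  have inj: "inj_on i I" unfolding i_def I_def using C
    by (intro inj_onI) (auto simp: from_nat_into_to_nat_on)
  have iI: "i ` I = C \<epsilon>" unfolding i_def I_def image_image using C by (auto simp: image_iff)
  define ab where "ab n = (if n \<in> I then (l \<epsilon> (i n), u \<epsilon> (i n)) else (0, 0))" for n
  let ?len = "\<lambda>n. snd (ab n) - fst (ab n)"
  have "ab \<in> {ab. (\<forall>n. 0 \<le> snd (ab n) - fst (ab n) \<and> snd (ab n) - fst (ab n) < \<epsilon>) \<and> S \<subseteq> (\<Union>n. cis ` {fst (ab n)..snd (ab n)})}"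
  proof (intro CollectI conjI allI)
    fix n show "0 \<le> ?len n" "?len n < \<epsilon>"
      using arcs[of "i n"] iI e by (auto simp: ab_def)
  next
    show "S \<subseteq> (\<Union>n. cis ` {fst (ab n)..snd (ab n)})"
    proof
      fix x assume "x \<in> S"
      with cover obtain j where j: "j \<in> C \<epsilon>" "x \<in> cis ` {l \<epsilon> j..u \<epsilon> j}" by blast
      from j(1) iI obtain n where "n \<in> I" "i n = j" by (metis imageE)
      with j have "n \<in> I" "x \<in> cis ` {l \<epsilon> (i n)..u \<epsilon> (i n)}" by auto
      thus "x \<in> (\<Union>n. cis ` {fst (ab n)..snd (ab n)})" by (intro UN_I[of n]) (auto simp: ab_def)
    qed
  qed
  moreover have "(\<Sum>n. ennreal (g (?len n))) \<le> B"
    unfolding suminf_eq_SUP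
  proof (rule SUP_least)
    fix N :: nat
    have "(\<Sum>n<N. ennreal (g (?len n))) = (\<Sum>n\<in>{..<N} \<inter> I. ennreal (g (?len n)))"
      using g by (intro sum.mono_neutral_right) (auto simp: ab_def)
    also have "\<dots> = (\<Sum>n\<in>{..<N} \<inter> I. ennreal (g (u \<epsilon> (i n) - l \<epsilon> (i n))))"
      by (intro sum.cong) (auto simp: ab_def)
    also have "\<dots> = (\<Sum>j\<in>i ` ({..<N} \<inter> I). ennreal (g (u \<epsilon> j - l \<epsilon> j)))"
      using inj by (subst sum.reindex) (auto intro: inj_on_subset)
    also have "\<dots> \<le> B" using iI by (intro sum) auto
    finally show "(\<Sum>n<N. ennreal (g (?len n))) \<le> B" .
  qed
  ultimately show "(INF ab\<in>{ab :: (nat \<Rightarrow> real) \<times> (nat \<Rightarrow> real).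
        (\<forall>n. 0 \<le> snd ab n - fst ab n \<and> snd ab n - fst ab n < \<epsilon>) \<and>
        S \<subseteq> (\<Union>n. cis ` {fst ab n..snd ab n})}.
        (\<Sum>n. ennreal (g (snd ab n - fst ab n)))) \<le> B"
    by (intro INF_lower2[of "(\<lambda>n. fst (ab n), \<lambda>n. snd (ab n))"]) auto
qed

text \<open>Each point of \<open>S\<close> has arbitrarily small \<open>\<delta>\<close> at which
  \<open>Re G\<close> is large, and then a disc of radius comparable to \<open>\<delta>\<close>
  carries mass at least a constant times \<open>\<delta> * (1 - ln \<delta>)\<close>. Disjoint discs
  have total mass at most \<open>Re (G 0)\<close>, a bound independent of
  \<open>\<epsilon>\<close>.\<close>

lemma H_meas_frequently_large:
  assumes G: "G holomorphic_on ball 0 1" and nonneg: "\<And>w. norm w < 1 \<Longrightarrow> 0 \<le> Re (G w)"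
    and growth: "\<And>w. norm w < 1 \<Longrightarrow> Re (G w) \<le> A * (1 - ln (1 - norm w))"
    and \<eta>: "0 < \<eta>"
    and S: "\<And>w. w \<in> S \<Longrightarrow> norm w = 1 \<and> (\<exists>\<^sub>F r in at_left 1. \<eta> * (1 - ln (1 - r)) < Re (G (of_real r * w)))"
  shows "H_meas lam S < \<infinity>"
proof -
  \<comment> \<open>Makes the far contribution \<open>64 * A * L / 2^K\<close> at most
    \<open>\<eta>/4 * L\<close>, half of the growth \<open>\<eta>/2 * L\<close> retained on the
    dilate.\<close>
  obtain K where K: "256 * A / \<eta> < 2 ^ K" using real_arch_pow[of 2 "256 * A / \<eta>"] by auto
  define L where "L \<delta> = 1 - ln \<delta>" for \<delta> :: real
  have ex: "\<exists>\<delta>. 0 < \<delta> \<and> \<delta> < d \<and> \<eta> * L \<delta> < Re (G (of_real (1 - \<delta>) * w))"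
    if "w \<in> S" "0 < d" "d \<le> 1" for w d
  proof -
    have "\<forall>\<^sub>F r in at_left (1::real). r \<in> {1 - d<..<1}" using that by (intro eventually_at_left_real) auto
    with S[OF that(1)] have "\<exists>\<^sub>F r in at_left 1. \<eta> * (1 - ln (1 - r)) < Re (G (of_real r * w)) \<and> r \<in> {1 - d<..<1}"
      by (auto intro: frequently_eventually_frequently)
    then obtain r where "\<eta> * (1 - ln (1 - r)) < Re (G (of_real r * w))" "r \<in> {1 - d<..<1}"
      by (auto dest: frequently_ex)
    thus ?thesis by (intro exI[of _ "1 - r"]) (auto simp: L_def)
  qed
  \<comment> \<open>The admissible \<open>R\<close> depend on the pair \<open>w\<close>,
    \<open>\<delta>\<close>, so this can be used for finitely many pairs at a time.\<close>
  have ev: "\<forall>\<^sub>F R in at_left 1. ennreal (\<eta> / 8 * \<delta> * L \<delta>) \<le>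
      emeasure (boundary_measure (\<lambda>z. G (of_real R * z))) {t. norm (cis (2*pi*t) - w) \<le> 2 ^ Suc K * \<delta>}"
    if w: "w \<in> S" and \<delta>: "0 < \<delta>" "\<delta> < 1" "\<eta> * L \<delta> < Re (G (of_real (1 - \<delta>) * w))" for w \<delta>
  proof -
    have L: "L \<delta> \<ge> 1" using \<delta> by (simp add: L_def)
    define z where "z = of_real (1 - \<delta>) * w"
    have nz: "norm z < 1" using S[OF w] \<delta> by (simp add: z_def norm_mult del: of_real_diff)
    have "isCont G (of_real 1 * z)"
      using G nz by (intro holomorphic_on_imp_continuous_on[THEN continuous_on_interior]) (auto simp: interior_open)
    hence "isCont (\<lambda>R. Re (G (of_real R * z))) 1"
      by (intro isCont_Re isCont_o2[where g=G and f="\<lambda>R. of_real R * z"]) (auto intro!: continuous_intros)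
    hence lim: "((\<lambda>R. Re (G (of_real R * z))) \<longlongrightarrow> Re (G z)) (at_left 1)"
      unfolding isCont_def by (auto intro: tendsto_mono[OF at_le])
    have "\<eta> / 2 * L \<delta> < \<eta> * L \<delta>" using L \<eta> by simp
    hence "\<eta> / 2 * L \<delta> < Re (G z)" using \<delta>(3) by (simp add: z_def)
    with lim have "\<forall>\<^sub>F R in at_left 1. \<eta> / 2 * L \<delta> < Re (G (of_real R * z))" by (rule order_tendstoD)
    moreover have "\<forall>\<^sub>F R in at_left (1::real). R \<in> {0<..<1}" by (intro eventually_at_left_real) auto
    ultimately show ?thesis
    proof eventually_elim
      case (elim R)
      define F where "F = (\<lambda>z. G (of_real R * z))"
      have nR: "norm (of_real R * u) < 1" "norm (of_real R * u) \<le> norm u" if "norm u \<le> 1" for u :: complex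
      proof -
        have R01: "0 < R" "R < 1" using elim by auto
        have "R * norm u \<le> R * 1" "R * norm u \<le> 1 * norm u"
          using elim that by (intro mult_left_mono mult_right_mono; simp)+
        hence "R * norm u < 1" "R * norm u \<le> norm u" using R01 by linarith+
        thus "norm (of_real R * u) < 1" "norm (of_real R * u) \<le> norm u"
          using elim by (simp_all add: norm_mult)
      qed
      have F: "F holomorphic_on cball 0 1" unfolding F_def
        by (intro holomorphic_on_compose_gen[OF _ G, unfolded o_def]) (auto intro!: holomorphic_intros simp: nR)
      define m where "m = emeasure (boundary_measure F) {t. norm (cis (2*pi*t) - w) \<le> 2 ^ Suc K * \<delta>}"
      have A: "0 \<le> A" using nonneg[of 0] growth[of 0] by auto
      have "ennreal (Re (F z)) \<le> ennreal (2 / \<delta>) * m + ennreal (64 * A * L \<delta> / 2 ^ K)"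
        unfolding z_def m_def L_def
      proof (rule re_le_local_boundary_mass[OF F])
        show "0 \<le> Re (F u)" if "norm u \<le> 1" for u unfolding F_def using nR[OF that] by (intro nonneg)
        \<comment> \<open>The majorant increases with the modulus, so the dilate inherits it with
          the same \<open>A\<close>; the estimate is uniform in \<open>R\<close>.\<close>
        show "Re (F u) \<le> A * (1 - ln (1 - norm u))" if "norm u < 1" for u
        proof -
          have "Re (F u) \<le> A * (1 - ln (1 - norm (of_real R * u)))"
            unfolding F_def using that nR[of u] by (intro growth) auto
          also have "\<dots> \<le> A * (1 - ln (1 - norm u))"
            using A that nR[of u] by (intro mult_left_mono diff_left_mono) auto
          finally show ?thesis .
        qed
      qed (use \<delta> S w in auto)
      moreover have "64 * A * L \<delta> / 2 ^ K \<le> \<eta> / 4 * L \<delta>"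
      proof -
        have "256 * A \<le> \<eta> * 2 ^ K" using K \<eta> by (simp add: field_simps)
        hence "64 * A / 2 ^ K \<le> \<eta> / 4" by (simp add: field_simps)
        from mult_right_mono[OF this, of "L \<delta>"] L show ?thesis by simp
      qed
      moreover have "\<eta> / 2 * L \<delta> \<le> Re (F z)" using elim by (simp add: F_def)
      ultimately have "ennreal (\<eta> / 2 * L \<delta>) \<le> ennreal (2 / \<delta>) * m + ennreal (\<eta> / 4 * L \<delta>)"
        by (meson add_left_mono ennreal_leI order_trans)
      hence "ennreal (\<eta> / 2 * L \<delta>) - ennreal (\<eta> / 4 * L \<delta>) \<le> ennreal (2 / \<delta>) * m"
        by (simp add: ennreal_minus_le_iff add.commute)
      hence "ennreal (\<eta> / 4 * L \<delta>) \<le> ennreal (2 / \<delta>) * m"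
        using \<eta> L by (subst (asm) ennreal_minus) auto
      hence "ennreal (\<delta> / 2) * ennreal (\<eta> / 4 * L \<delta>) \<le> ennreal (\<delta> / 2) * (ennreal (2 / \<delta>) * m)"
        by (rule mult_left_mono) simp
      also have "ennreal (\<delta> / 2) * (ennreal (2 / \<delta>) * m) = m"
        using \<delta> by (simp add: mult.assoc[symmetric] ennreal_mult[symmetric])
      also have "ennreal (\<delta> / 2) * ennreal (\<eta> / 4 * L \<delta>) = ennreal (\<eta> / 8 * \<delta> * L \<delta>)"
        using \<delta> \<eta> L by (subst ennreal_mult[symmetric]) (auto simp: mult_ac)
      finally show ?case by (simp add: m_def F_def)
    qed
  qed
  \<comment> \<open>The covering arc has length \<open>Q * \<delta>\<close>: the radius
    \<open>2^Suc K * \<delta>\<close> is enlarged 5 times by Vitali, twice by passing from chord to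
    angle, and counted on both sides.\<close>
  define Q :: real where "Q = 20 * 2 ^ Suc K"
  have Q: "Q \<ge> 1" unfolding Q_def using one_le_power[of "2::real" "Suc K"] by linarith
  \<comment> \<open>The bound by \<open>\<epsilon> / Q\<close> makes the arcs short enough; the
    bound by \<open>1 / Q\<close> fixes the sign of the logarithm in
    \<open>lam (Q * \<delta>)\<close>.\<close>
  define dl where "dl \<epsilon> w = (SOME \<delta>. 0 < \<delta> \<and> \<delta> < min \<epsilon> 1 / Q \<and> \<eta> * L \<delta> < Re (G (of_real (1 - \<delta>) * w)))" for \<epsilon> w
  have dl: "0 < dl \<epsilon> w" "dl \<epsilon> w < min \<epsilon> 1 / Q" "\<eta> * L (dl \<epsilon> w) < Re (G (of_real (1 - dl \<epsilon> w) * w))"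
    if "\<epsilon> > 0" "w \<in> S" for \<epsilon> w
  proof -
    have "\<exists>\<delta>. 0 < \<delta> \<and> \<delta> < min \<epsilon> 1 / Q \<and> \<eta> * L \<delta> < Re (G (of_real (1 - \<delta>) * w))"
      using that Q by (intro ex) (auto simp: min_def field_simps)
    from someI_ex[OF this] show "0 < dl \<epsilon> w" "dl \<epsilon> w < min \<epsilon> 1 / Q" "\<eta> * L (dl \<epsilon> w) < Re (G (of_real (1 - dl \<epsilon> w) * w))"
      unfolding dl_def by auto
  qed
  have dl': "Q * dl \<epsilon> w < \<epsilon>" "Q * dl \<epsilon> w < 1" "dl \<epsilon> w < 1" if "\<epsilon> > 0" "w \<in> S" for \<epsilon> w
  proof -
    have "Q * dl \<epsilon> w < min \<epsilon> 1" using dl(2)[OF that] Q by (simp add: field_simps)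
    thus "Q * dl \<epsilon> w < \<epsilon>" "Q * dl \<epsilon> w < 1" by auto
    moreover have "1 * dl \<epsilon> w \<le> Q * dl \<epsilon> w" using Q dl[OF that] by (intro mult_right_mono) auto
    ultimately show "dl \<epsilon> w < 1" by simp
  qed
  define \<rho> where "\<rho> \<epsilon> w = 2 ^ Suc K * dl \<epsilon> w" for \<epsilon> w
  have \<rho>Q: "20 * \<rho> \<epsilon> w = Q * dl \<epsilon> w" for \<epsilon> w by (simp add: \<rho>_def Q_def)
  have \<rho>: "0 < \<rho> \<epsilon> w \<and> \<rho> \<epsilon> w \<le> 1" if "\<epsilon> > 0" "w \<in> S" for \<epsilon> w
    using dl[OF that] dl'[OF that] \<rho>Q[of \<epsilon> w] by (auto simp: \<rho>_def)
  have "\<forall>\<epsilon>\<in>{0<..}. \<exists>C. countable C \<and> C \<subseteq> S \<and> disjoint_family_on (\<lambda>w. cball w (\<rho> \<epsilon> w)) C \<and> S \<subseteq> (\<Union>w\<in>C. cball w (5 * \<rho> \<epsilon> w))"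
  proof
    fix \<epsilon> :: real assume "\<epsilon> \<in> {0<..}"
    hence e: "\<epsilon> > 0" by simp
    have "S \<subseteq> (\<Union>w\<in>S. cball w (\<rho> \<epsilon> w))"
    proof
      fix w assume w: "w \<in> S"
      with \<rho>[OF e w] show "w \<in> (\<Union>w\<in>S. cball w (\<rho> \<epsilon> w))" by (intro UN_I[of w]) auto
    qed
    from Vitali_covering_lemma_cballs[OF this \<rho>[OF e]]
    obtain C where C: "countable C" "C \<subseteq> S" "pairwise (\<lambda>i j. disjnt (cball i (\<rho> \<epsilon> i)) (cball j (\<rho> \<epsilon> j))) C"
      "S \<subseteq> (\<Union>w\<in>C. cball w (5 * \<rho> \<epsilon> w))" .
    have "disjoint_family_on (\<lambda>w. cball w (\<rho> \<epsilon> w)) C"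
      using C(3) by (simp only: disjoint_family_on_def pairwise_def disjnt_def)
    with C show "\<exists>C. countable C \<and> C \<subseteq> S \<and> disjoint_family_on (\<lambda>w. cball w (\<rho> \<epsilon> w)) C \<and> S \<subseteq> (\<Union>w\<in>C. cball w (5 * \<rho> \<epsilon> w))"
      by blast
  qed
  from bchoice[OF this] obtain C where C: "\<forall>\<epsilon>\<in>{0<..}. countable (C \<epsilon>) \<and> C \<epsilon> \<subseteq> S \<and> disjoint_family_on (\<lambda>w. cball w (\<rho> \<epsilon> w)) (C \<epsilon>) \<and> S \<subseteq> (\<Union>w\<in>C \<epsilon>. cball w (5 * \<rho> \<epsilon> w))" ..
  have C: "countable (C \<epsilon>)" "C \<epsilon> \<subseteq> S" "disjoint_family_on (\<lambda>w. cball w (\<rho> \<epsilon> w)) (C \<epsilon>)"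
     "S \<subseteq> (\<Union>w\<in>C \<epsilon>. cball w (5 * \<rho> \<epsilon> w))" if "\<epsilon> > 0" for \<epsilon>
    using C[rule_format, of \<epsilon>] that by blast+
  have cisArg: "cis (Arg w) = w" if "w \<in> S" for w
  proof -
    have n: "norm w = 1" using S[OF that] by blast
    hence "w \<noteq> 0" by auto
    thus ?thesis using n by (simp add: cis_Arg sgn_div_norm)
  qed
  have "H_meas lam S \<le> ennreal (8 * Q / \<eta>) * ennreal (Re (G 0))"
  proof (rule H_meas_le_countable[where C=C and l="\<lambda>\<epsilon> w. Arg w - 2 * (5 * \<rho> \<epsilon> w)" and u="\<lambda>\<epsilon> w. Arg w + 2 * (5 * \<rho> \<epsilon> w)"])
    fix \<epsilon> :: real assume e: "\<epsilon> > 0"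
    show "countable (C \<epsilon>)" using C e by auto
    show "0 \<le> (Arg w + 2 * (5 * \<rho> \<epsilon> w)) - (Arg w - 2 * (5 * \<rho> \<epsilon> w)) \<and> (Arg w + 2 * (5 * \<rho> \<epsilon> w)) - (Arg w - 2 * (5 * \<rho> \<epsilon> w)) < \<epsilon>"
      if "w \<in> C \<epsilon>" for w
    proof -
      have "w \<in> S" using C(2)[OF e] that by auto
      from dl'[OF e this] \<rho>[OF e this] \<rho>Q[of \<epsilon> w] show ?thesis by auto
    qed
    show "S \<subseteq> (\<Union>w\<in>C \<epsilon>. cis ` {Arg w - 2 * (5 * \<rho> \<epsilon> w)..Arg w + 2 * (5 * \<rho> \<epsilon> w)})"
    proof
      fix x assume x: "x \<in> S"
      then obtain w where w: "w \<in> C \<epsilon>" "x \<in> cball w (5 * \<rho> \<epsilon> w)" using C(4)[OF e] by auto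
      have wS: "w \<in> S" using C(2)[OF e] w by auto
      have "x \<in> cball (cis (Arg w)) (5 * \<rho> \<epsilon> w) \<inter> range cis"
        using w(2) cisArg[OF wS] cisArg[OF x] rangeI[of cis "Arg x"] by simp
      with cball_inter_circle_subset_arc[of "5 * \<rho> \<epsilon> w" "Arg w"] \<rho>[OF e wS]
      have "x \<in> cis ` {Arg w - 2 * (5 * \<rho> \<epsilon> w)..Arg w + 2 * (5 * \<rho> \<epsilon> w)}" by auto
      with w show "x \<in> (\<Union>w\<in>C \<epsilon>. cis ` {Arg w - 2 * (5 * \<rho> \<epsilon> w)..Arg w + 2 * (5 * \<rho> \<epsilon> w)})" by blast
    qed
    fix J assume J: "finite J" "J \<subseteq> C \<epsilon>"
    have JS: "w \<in> S" if "w \<in> J" for w using that J C(2)[OF e] by auto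
    \<comment> \<open>Finiteness of \<open>J\<close> yields one radius \<open>R\<close> that serves
      all selected discs, whose masses then live on the same circle and can be added.\<close>
    have "\<forall>\<^sub>F R in at_left 1. \<forall>w\<in>J. ennreal (\<eta> / 8 * dl \<epsilon> w * L (dl \<epsilon> w)) \<le>
      emeasure (boundary_measure (\<lambda>z. G (of_real R * z))) {t. norm (cis (2*pi*t) - w) \<le> \<rho> \<epsilon> w}"
      unfolding \<rho>_def using J dl[OF e] dl'[OF e] JS by (intro eventually_ball_finite ballI ev) auto
    moreover have "\<forall>\<^sub>F R in at_left (1::real). R \<in> {0<..<1}" by (intro eventually_at_left_real) auto
    ultimately have "\<forall>\<^sub>F R in at_left 1. (\<forall>w\<in>J. ennreal (\<eta> / 8 * dl \<epsilon> w * L (dl \<epsilon> w)) \<le>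
      emeasure (boundary_measure (\<lambda>z. G (of_real R * z))) {t. norm (cis (2*pi*t) - w) \<le> \<rho> \<epsilon> w}) \<and> R \<in> {0<..<1}"
      by (rule eventually_conj)
    then obtain R where R: "\<And>w. w \<in> J \<Longrightarrow> ennreal (\<eta> / 8 * dl \<epsilon> w * L (dl \<epsilon> w)) \<le>
      emeasure (boundary_measure (\<lambda>z. G (of_real R * z))) {t. norm (cis (2*pi*t) - w) \<le> \<rho> \<epsilon> w}" "0 < R" "R < 1"
      using eventually_happens'[OF trivial_limit_at_left_real, of _ 1] unfolding greaterThanLessThan_iff by blast
    define M where "M = boundary_measure (\<lambda>z. G (of_real R * z))"
    have nR: "norm (of_real R * u) < 1" if "norm u \<le> 1" for u :: complex
    proof -
      have "R * norm u \<le> R * 1" using R that by (intro mult_left_mono) auto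
      hence "R * norm u < 1" using R by linarith
      thus ?thesis using R by (simp add: norm_mult)
    qed
    have "(\<Sum>w\<in>J. ennreal (\<eta> / 8 * dl \<epsilon> w * L (dl \<epsilon> w))) \<le> (\<Sum>w\<in>J. emeasure M {t. norm (cis (2*pi*t) - w) \<le> \<rho> \<epsilon> w})"
      unfolding M_def by (intro sum_mono R)
    also have "\<dots> = emeasure M (\<Union>w\<in>J. {t. norm (cis (2*pi*t) - w) \<le> \<rho> \<epsilon> w})"
    proof (intro sum_emeasure)
      show "(\<lambda>w. {t. norm (cis (2*pi*t) - w) \<le> \<rho> \<epsilon> w}) ` J \<subseteq> sets M" unfolding M_def by auto
      show "disjoint_family_on (\<lambda>w. {t. norm (cis (2*pi*t) - w) \<le> \<rho> \<epsilon> w}) J"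
        unfolding disjoint_family_on_def
      proof (intro ballI impI)
        fix v w assume vw: "v \<in> J" "w \<in> J" "v \<noteq> w"
        hence "cball v (\<rho> \<epsilon> v) \<inter> cball w (\<rho> \<epsilon> w) = {}"
          using C(3)[OF e] J unfolding disjoint_family_on_def by blast
        moreover have "cis (2*pi*t) \<in> cball v (\<rho> \<epsilon> v) \<inter> cball w (\<rho> \<epsilon> w)"
          if "t \<in> {t. norm (cis (2*pi*t) - v) \<le> \<rho> \<epsilon> v} \<inter> {t. norm (cis (2*pi*t) - w) \<le> \<rho> \<epsilon> w}" for t
          using that by (auto simp: dist_norm norm_minus_commute)
        ultimately show "{t. norm (cis (2*pi*t) - v) \<le> \<rho> \<epsilon> v} \<inter> {t. norm (cis (2*pi*t) - w) \<le> \<rho> \<epsilon> w} = {}" by blast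
      qed
    qed (use J in auto)
    also have "\<dots> \<le> emeasure M UNIV" by (intro emeasure_mono) (auto simp: M_def)
    also have "\<dots> = ennreal (Re (G 0))" unfolding M_def
    proof (subst boundary_measure_total)
      show "(\<lambda>z. G (of_real R * z)) holomorphic_on cball 0 1"
        by (intro holomorphic_on_compose_gen[OF _ G, unfolded o_def]) (auto intro!: holomorphic_intros simp: nR)
      show "0 \<le> Re (G (of_real R * w))" if "norm w = 1" for w using that nR by (intro nonneg) auto
    qed simp
    finally have le: "(\<Sum>w\<in>J. ennreal (\<eta> / 8 * dl \<epsilon> w * L (dl \<epsilon> w))) \<le> ennreal (Re (G 0))" .
    have "(\<Sum>w\<in>J. ennreal (lam ((Arg w + 2 * (5 * \<rho> \<epsilon> w)) - (Arg w - 2 * (5 * \<rho> \<epsilon> w)))))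
       \<le> (\<Sum>w\<in>J. ennreal (8 * Q / \<eta>) * ennreal (\<eta> / 8 * dl \<epsilon> w * L (dl \<epsilon> w)))"
    proof (rule sum_mono)
      fix w assume "w \<in> J"
      note w = JS[OF this]
      have "lam ((Arg w + 2 * (5 * \<rho> \<epsilon> w)) - (Arg w - 2 * (5 * \<rho> \<epsilon> w))) = lam (Q * dl \<epsilon> w)"
        using \<rho>Q[of \<epsilon> w] by (simp add: algebra_simps)
      also have "\<dots> = Q * dl \<epsilon> w * \<bar>ln (Q * dl \<epsilon> w)\<bar>" by (simp add: lam_def)
      \<comment> \<open>As \<open>Q * dl \<epsilon> w < 1\<close> and \<open>Q \<ge> 1\<close>,
        enlarging the arc by \<open>Q\<close> only shrinks the absolute logarithm.\<close>
      also have "\<bar>ln (Q * dl \<epsilon> w)\<bar> \<le> L (dl \<epsilon> w)"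
      proof -
        have "ln (Q * dl \<epsilon> w) = ln Q + ln (dl \<epsilon> w)" using Q dl[OF e w] by (intro ln_mult_pos) auto
        moreover have "ln Q \<ge> 0" using Q by simp
        moreover have "ln (Q * dl \<epsilon> w) \<le> 0" using Q dl[OF e w] dl'[OF e w] by (intro ln_le_zero_iff[THEN iffD2]) auto
        ultimately show ?thesis by (simp add: L_def)
      qed
      hence "Q * dl \<epsilon> w * \<bar>ln (Q * dl \<epsilon> w)\<bar> \<le> Q * dl \<epsilon> w * L (dl \<epsilon> w)"
        using Q dl[OF e w] by (intro mult_left_mono) auto
      also have "\<dots> = 8 * Q / \<eta> * (\<eta> / 8 * dl \<epsilon> w * L (dl \<epsilon> w))" using \<eta> by simp
      finally have "lam ((Arg w + 2 * (5 * \<rho> \<epsilon> w)) - (Arg w - 2 * (5 * \<rho> \<epsilon> w))) \<le> 8 * Q / \<eta> * (\<eta> / 8 * dl \<epsilon> w * L (dl \<epsilon> w))" .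
      thus "ennreal (lam ((Arg w + 2 * (5 * \<rho> \<epsilon> w)) - (Arg w - 2 * (5 * \<rho> \<epsilon> w)))) \<le> ennreal (8 * Q / \<eta>) * ennreal (\<eta> / 8 * dl \<epsilon> w * L (dl \<epsilon> w))"
      proof -
        have "L (dl \<epsilon> w) \<ge> 0" using dl(1)[OF e w] dl'(3)[OF e w] ln_le_zero_iff[of "dl \<epsilon> w"] by (auto simp: L_def intro: order_trans[of _ 0])
        hence "0 \<le> \<eta> / 8 * dl \<epsilon> w * L (dl \<epsilon> w)" using \<eta> dl(1)[OF e w] by simp
        moreover have "0 \<le> 8 * Q / \<eta>" using Q \<eta> by simp
        ultimately show ?thesis
          using \<open>lam ((Arg w + 2 * (5 * \<rho> \<epsilon> w)) - (Arg w - 2 * (5 * \<rho> \<epsilon> w))) \<le> 8 * Q / \<eta> * (\<eta> / 8 * dl \<epsilon> w * L (dl \<epsilon> w))\<close> by (subst ennreal_mult[symmetric]) (simp_all only: ennreal_leI)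
      qed
    qed
    also have "\<dots> = ennreal (8 * Q / \<eta>) * (\<Sum>w\<in>J. ennreal (\<eta> / 8 * dl \<epsilon> w * L (dl \<epsilon> w)))"
      by (rule sum_distrib_left[symmetric])
    also have "\<dots> \<le> ennreal (8 * Q / \<eta>) * ennreal (Re (G 0))" by (intro mult_left_mono le) simp
    finally show "(\<Sum>w\<in>J. ennreal (lam ((Arg w + 2 * (5 * \<rho> \<epsilon> w)) - (Arg w - 2 * (5 * \<rho> \<epsilon> w))))) \<le> ennreal (8 * Q / \<eta>) * ennreal (Re (G 0))" .
  qed (simp add: lam_def)
  also have "\<dots> < \<infinity>" by (simp add: ennreal_mult_less_top)
  finally show ?thesis .
qed

section \<open>From the analytic function to a positive harmonic function, and the decomposition of
  \<open>G_plus\<close>\<close>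

text \<open>The quotient \<open>f / c\<close> has no zeros in the simply connected disc, so it has a
  holomorphic logarithm \<open>G\<close>. Since \<open>1 - ln (1 - norm z)\<close> is at least 1, it
  absorbs the additive constant \<open>ln C - ln c\<close> as well as the power growth.\<close>

lemma log_modulus_of_bounded_below:
  assumes f: "f \<in> A_minus_infty" and c: "0 < c" and below: "\<And>z. z \<in> ball 0 1 \<Longrightarrow> c \<le> norm (f z)"
  obtains G A where "G holomorphic_on ball 0 1"
    "\<And>z. norm z < 1 \<Longrightarrow> Re (G z) = ln (norm (f z)) - ln c"
    "\<And>z. norm z < 1 \<Longrightarrow> 0 \<le> Re (G z)"
    "\<And>z. norm z < 1 \<Longrightarrow> Re (G z) \<le> A * (1 - ln (1 - norm z))"
proof -
  from f obtain C k where hol: "f holomorphic_on ball 0 1"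
    and above: "\<And>z. z \<in> ball 0 1 \<Longrightarrow> norm (f z) \<le> C * (1 - norm z) powr (- k)"
    unfolding A_minus_infty_def by blast
  have C: "0 < C" using above[of 0] below[of 0] c by simp
  have fpos: "0 < norm (f z)" if "norm z < 1" for z using below[of z] c that by auto
  have "(\<lambda>z. f z / of_real c) holomorphic_on ball 0 1" using c by (intro holomorphic_intros hol) auto
  then obtain G where G: "G holomorphic_on ball 0 1" "\<And>z. z \<in> ball 0 1 \<Longrightarrow> exp (G z) = f z / of_real c"
    using fpos c holomorphic_logarithm_exists[of "ball 0 1" "\<lambda>z. f z / of_real c" 0] by auto
  have re: "Re (G z) = ln (norm (f z)) - ln c" if "norm z < 1" for z
  proof -
    have "exp (Re (G z)) = norm (f z) / c"
      using G(2)[of z] that c norm_exp_eq_Re[of "G z"] by (simp add: norm_divide)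
    hence "Re (G z) = ln (norm (f z) / c)" by (metis ln_exp)
    thus ?thesis using fpos[OF that] c by (simp add: ln_div)
  qed
  show thesis
  proof (rule that[OF G(1) re, of "\<bar>ln C - ln c\<bar> + \<bar>k\<bar>"])
    fix z :: complex assume z: "norm z < 1"
    show "0 \<le> Re (G z)" using below[of z] z c fpos[OF z] by (simp add: re)
    have l: "ln (1 - norm z) \<le> 0" using z by simp
    have "ln (norm (f z)) \<le> ln (C * (1 - norm z) powr (- k))"
      using above[of z] z fpos[OF z] C by (intro ln_mono) auto
    also have "\<dots> = ln C + k * (- ln (1 - norm z))" using C z by (simp add: ln_mult ln_powr)
    also have "k * (- ln (1 - norm z)) \<le> \<bar>k\<bar> * (- ln (1 - norm z))" using l by (intro mult_right_mono) auto
    finally have "Re (G z) \<le> (ln C - ln c) + \<bar>k\<bar> * (- ln (1 - norm z))" using re[OF z] by simp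
    also have "\<dots> \<le> \<bar>ln C - ln c\<bar> * (1 - ln (1 - norm z)) + \<bar>k\<bar> * (1 - ln (1 - norm z))"
    proof (rule add_mono)
      have "\<bar>ln C - ln c\<bar> * 1 \<le> \<bar>ln C - ln c\<bar> * (1 - ln (1 - norm z))" using l by (intro mult_left_mono) auto
      thus "ln C - ln c \<le> \<bar>ln C - ln c\<bar> * (1 - ln (1 - norm z))" by simp
    qed (intro mult_left_mono; simp)
    finally show "Re (G z) \<le> (\<bar>ln C - ln c\<bar> + \<bar>k\<bar>) * (1 - ln (1 - norm z))" by (simp add: distrib_right)
  qed
qed

text \<open>A positive limsup exceeds some \<open>1/(n+1)\<close>, so sorting the points by this
  threshold gives countably many sets to which the covering estimate applies.\<close>

lemma G_plus_decomposition:
  assumes f: "f \<in> A_minus_infty" and c: "0 < c" and below: "\<And>z. z \<in> ball 0 1 \<Longrightarrow> c \<le> norm (f z)"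
  shows "\<exists>S :: nat \<Rightarrow> complex set. G_plus f = (\<Union>n. S n) \<and> (\<forall>n. H_meas lam (S n) < \<infinity>)"
proof -
  obtain G A where G: "G holomorphic_on ball 0 1"
    and re: "\<And>z. norm z < 1 \<Longrightarrow> Re (G z) = ln (norm (f z)) - ln c"
    and nonneg: "\<And>z. norm z < 1 \<Longrightarrow> 0 \<le> Re (G z)"
    and growth: "\<And>z. norm z < 1 \<Longrightarrow> Re (G z) \<le> A * (1 - ln (1 - norm z))"
    using log_modulus_of_bounded_below[OF f c below] by blast
  define S where "S n = {w \<in> G_plus f. \<exists>\<^sub>F r in at_left 1. inverse (real (Suc n)) * (1 - ln (1 - r)) < Re (G (of_real r * w))}" for n
  have "G_plus f \<subseteq> (\<Union>n. S n)"
  proof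
    fix w assume w: "w \<in> G_plus f"
    then obtain \<theta> where \<theta>: "w = cis \<theta>"
      and lim: "Limsup (at_left 1) (\<lambda>r::real. ereal (ln (norm (f (of_real r * w))) / \<bar>ln (1 - r)\<bar>)) > 0"
      by (auto simp: G_plus_def)
    from ereal_dense2[OF lim] obtain \<eta> where \<eta>: "0 < \<eta>"
      and lim: "ereal \<eta> < Limsup (at_left 1) (\<lambda>r::real. ereal (ln (norm (f (of_real r * w))) / \<bar>ln (1 - r)\<bar>))"
      by (auto simp: zero_ereal_def)
    obtain n where n: "inverse (real (Suc n)) < \<eta>" using reals_Archimedean[OF \<eta>] by auto
    define a where "a = inverse (real (Suc n))"
    have a: "0 < a" "a < \<eta>" using n by (auto simp: a_def)
    have freq: "\<exists>\<^sub>F r in at_left 1. \<eta> < ln (norm (f (of_real r * w))) / \<bar>ln (1 - r)\<bar>"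
    proof (rule ccontr)
      assume "\<not> ?thesis"
      hence "\<forall>\<^sub>F r in at_left 1. ereal (ln (norm (f (of_real r * w))) / \<bar>ln (1 - r)\<bar>) \<le> ereal \<eta>"
        by (simp add: not_frequently not_less)
      from Limsup_bounded[OF this] lim show False by simp
    qed
    have "filterlim (\<lambda>r::real. 1 - r) (at_right 0) (at_left 1)"
      by (auto intro!: filterlim_atI tendsto_eq_intros simp: eventually_at_filter filterlim_at)
    hence "filterlim (\<lambda>r::real. ln (1 - r)) at_bot (at_left 1)"
      by (rule filterlim_compose[OF ln_at_0])
    \<comment> \<open>The gap between \<open>a\<close> and \<open>\<eta>\<close>, multiplied by the
      divergent logarithm, eventually outweighs the shift \<open>ln c\<close> and the extra summand
      \<open>a\<close> in \<open>a * (1 - ln (1 - r))\<close>.\<close>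
    hence "\<forall>\<^sub>F r in at_left 1. ln (1 - r) < - ((\<bar>ln c\<bar> + a) / (\<eta> - a))"
      by (auto simp: filterlim_at_bot_dense)
    moreover have "\<forall>\<^sub>F r in at_left (1::real). r \<in> {0<..<1}" by (intro eventually_at_left_real) auto
    ultimately have "\<forall>\<^sub>F r in at_left 1. ln (1 - r) < - ((\<bar>ln c\<bar> + a) / (\<eta> - a)) \<and> r \<in> {0<..<1}" by (rule eventually_conj)
    from frequently_eventually_frequently[OF freq this]
    have "\<exists>\<^sub>F r in at_left 1. a * (1 - ln (1 - r)) < Re (G (of_real r * w))"
    proof (rule frequently_elim1)
      fix r assume r: "\<eta> < ln (norm (f (of_real r * w))) / \<bar>ln (1 - r)\<bar> \<and> ln (1 - r) < - ((\<bar>ln c\<bar> + a) / (\<eta> - a)) \<and> r \<in> {0<..<1}"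
      hence l: "ln (1 - r) < 0" by simp
      have "norm (of_real r * w) < 1" using r by (simp add: \<theta> norm_mult)
      hence re: "Re (G (of_real r * w)) = ln (norm (f (of_real r * w))) - ln c" by (rule re)
      have "\<eta> * - ln (1 - r) < ln (norm (f (of_real r * w)))" using r l by (simp add: field_simps)
      moreover have "\<bar>ln c\<bar> + a < (\<eta> - a) * - ln (1 - r)"
      proof -
        have "(\<bar>ln c\<bar> + a) / (\<eta> - a) < - ln (1 - r)" using r by linarith
        thus ?thesis using a by (simp add: pos_divide_less_eq mult.commute)
      qed
      ultimately show "a * (1 - ln (1 - r)) < Re (G (of_real r * w))"
        unfolding re by (simp add: algebra_simps)
    qed
    with w show "w \<in> (\<Union>n. S n)" by (auto simp: S_def a_def)
  qed
  hence "G_plus f = (\<Union>n. S n)" by (auto simp: S_def)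
  moreover have "H_meas lam (S n) < \<infinity>" for n
    by (rule H_meas_frequently_large[OF G nonneg growth, of "inverse (real (Suc n))"])
       (auto simp: S_def G_plus_def)
  ultimately show ?thesis by blast
qed

subsection \<open>Herglotz transforms\<close>

text \<open>The Herglotz transform of the image of \<open>M\<close> under
  \<open>cis \<circ> X\<close>, written as an integral over the source so that the image measure
  never has to be formed.\<close>

definition herglotz :: "'a measure \<Rightarrow> ('a \<Rightarrow> real) \<Rightarrow> complex \<Rightarrow> complex" where
  "herglotz M X z = (\<integral>x. (cis (X x) + z) / (cis (X x) - z) \<partial>M)"

lemma norm_cis_diff_ge: "1 - norm z \<le> norm (cis t - z)"
  using norm_triangle_ineq2[of "cis t" z] by simp

lemma norm_herglotz_kernel_le:
  assumes "norm z < 1"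
  shows "norm ((cis t + z) / (cis t - z)) \<le> 2 / (1 - norm z)"
proof -
  have "norm (cis t + z) \<le> 2" using norm_triangle_ineq[of "cis t" z] assms by simp
  thus ?thesis unfolding norm_divide using assms norm_cis_diff_ge[of z t] by (intro frac_le) auto
qed

lemma Re_herglotz_kernel: "Re ((cis t + z) / (cis t - z)) = (1 - (norm z)\<^sup>2) / (norm (cis t - z))\<^sup>2"
proof -
  define w where "w = cis t"
  have w: "(Re w)\<^sup>2 + (Im w)\<^sup>2 = 1" by (simp add: w_def)
  have "Re ((w + z) / (w - z)) = ((Re w)\<^sup>2 + (Im w)\<^sup>2 - ((Re z)\<^sup>2 + (Im z)\<^sup>2)) / (norm (w - z))\<^sup>2"
    unfolding Re_divide cmod_power2 by (simp add: power2_eq_square algebra_simps)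
  thus ?thesis unfolding w by (simp add: w_def cmod_power2)
qed

context finite_measure
begin

lemma herglotz_kernel_integrable:
  assumes [measurable]: "X \<in> borel_measurable M" and z: "norm z < 1"
  shows "integrable M (\<lambda>x. (cis (X x) + z) / (cis (X x) - z))"
  by (rule integrable_const_bound[where B="2 / (1 - norm z)"]) (auto simp: norm_herglotz_kernel_le z)

lemma norm_herglotz_le:
  assumes [measurable]: "X \<in> borel_measurable M" and z: "norm z < 1"
  shows "norm (herglotz M X z) \<le> measure M (space M) * (2 / (1 - norm z))"
proof -
  have "norm (herglotz M X z) \<le> (\<integral>x. norm ((cis (X x) + z) / (cis (X x) - z)) \<partial>M)"
    unfolding herglotz_def by (rule integral_norm_bound)
  also have "\<dots> \<le> (\<integral>x. 2 / (1 - norm z) \<partial>M)"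
    by (intro integral_mono integrable_norm herglotz_kernel_integrable norm_herglotz_kernel_le z) auto
  finally show ?thesis by simp
qed

lemma Re_herglotz:
  assumes [measurable]: "X \<in> borel_measurable M" and z: "norm z < 1"
  shows "ennreal (Re (herglotz M X z)) = ennreal (1 - (norm z)\<^sup>2) * (\<integral>\<^sup>+x. ennreal (1 / (norm (cis (X x) - z))\<^sup>2) \<partial>M)"
    and "0 \<le> Re (herglotz M X z)"
proof -
  have p: "0 \<le> 1 - (norm z)\<^sup>2" using z by (simp add: power_le_one)
  have i: "integrable M (\<lambda>x. (1 - (norm z)\<^sup>2) / (norm (cis (X x) - z))\<^sup>2)"
    unfolding Re_herglotz_kernel[symmetric] by (intro integrable_Re herglotz_kernel_integrable z) auto
  have e: "Re (herglotz M X z) = (\<integral>x. (1 - (norm z)\<^sup>2) / (norm (cis (X x) - z))\<^sup>2 \<partial>M)"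
    unfolding Re_herglotz_kernel[symmetric] herglotz_def
    by (subst integral_Re[symmetric]) (auto intro: herglotz_kernel_integrable z)
  show "0 \<le> Re (herglotz M X z)" unfolding e using p by (intro integral_nonneg_AE) auto
  have "ennreal (Re (herglotz M X z)) = (\<integral>\<^sup>+x. ennreal ((1 - (norm z)\<^sup>2) / (norm (cis (X x) - z))\<^sup>2) \<partial>M)"
    unfolding e using p by (intro nn_integral_eq_integral[symmetric] i) auto
  also have "\<dots> = (\<integral>\<^sup>+x. ennreal (1 - (norm z)\<^sup>2) * ennreal (1 / (norm (cis (X x) - z))\<^sup>2) \<partial>M)"
    using p by (intro nn_integral_cong) (simp add: ennreal_mult[symmetric])
  also have "\<dots> = ennreal (1 - (norm z)\<^sup>2) * (\<integral>\<^sup>+x. ennreal (1 / (norm (cis (X x) - z))\<^sup>2) \<partial>M)"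
    by (rule nn_integral_cmult) measurable
  finally show "ennreal (Re (herglotz M X z)) = ennreal (1 - (norm z)\<^sup>2) * (\<integral>\<^sup>+x. ennreal (1 / (norm (cis (X x) - z))\<^sup>2) \<partial>M)" .
qed

text \<open>The kernel is \<open>2 / (1 - cis (- X x) * z) - 1\<close>. Expanding it as a geometric
  series and integrating termwise gives a power series with the Fourier coefficients
  \<open>c k\<close>.\<close>

lemma herglotz_holomorphic:
  assumes [measurable]: "X \<in> borel_measurable M"
  shows "herglotz M X holomorphic_on ball 0 1"
proof -
  define c where "c k = (\<integral>x. cis (- (real k * X x)) \<partial>M)" for k :: nat
  have int: "integrable M (\<lambda>x. cis (- (real k * X x)))" for k
    by (rule integrable_const_bound[where B=1]) auto
  have "(\<lambda>k. c k * (z - 0) ^ k) sums ((herglotz M X z + measure M (space M)) / 2)" if "z \<in> ball 0 1" for z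
  proof -
    have z: "norm z < 1" using that by simp
    have s: "(\<lambda>k. cis (- (real k * X x)) * z ^ k) sums (((cis (X x) + z) / (cis (X x) - z) + 1) / 2)" for x
    proof -
      have "(\<lambda>k. (cis (- X x) * z) ^ k) sums (1 / (1 - cis (- X x) * z))"
        using z by (intro geometric_sums) (simp add: norm_mult)
      moreover have "(cis (- X x) * z) ^ k = cis (- (real k * X x)) * z ^ k" for k
        by (simp add: power_mult_distrib Complex.DeMoivre)
      moreover have "1 / (1 - cis (- X x) * z) = ((cis (X x) + z) / (cis (X x) - z) + 1) / 2"
      proof -
        have "cis (X x) \<noteq> z" using z norm_cis[of "X x"] by (metis less_irrefl)
        hence nz: "cis (X x) - z \<noteq> 0" by simp
        have "1 - cis (- X x) * z = (cis (X x) - z) / cis (X x)"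
          by (simp add: diff_divide_distrib cis_divide[of 0, simplified, symmetric])
        hence "1 / (1 - cis (- X x) * z) = cis (X x) / (cis (X x) - z)" by simp
        also have "\<dots> = ((cis (X x) + z) / (cis (X x) - z) + 1) / 2"
          using nz by (simp add: divide_simps)
        finally show ?thesis .
      qed
      ultimately show ?thesis by simp
    qed
    have "(\<lambda>k. \<integral>x. cis (- (real k * X x)) * z ^ k \<partial>M) sums (\<integral>x. (\<Sum>k. cis (- (real k * X x)) * z ^ k) \<partial>M)"
    proof (rule sums_integral)
      show "integrable M (\<lambda>x. cis (- (real k * X x)) * z ^ k)" for k
        using int[of k] by simp
      show "AE x in M. summable (\<lambda>k. norm (cis (- (real k * X x)) * z ^ k))"
        using z by (simp add: norm_mult norm_power summable_geometric)
      show "summable (\<lambda>k. \<integral>x. norm (cis (- (real k * X x)) * z ^ k) \<partial>M)"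
        using z by (simp add: norm_mult norm_power summable_geometric)
    qed
    moreover have "(\<integral>x. (\<Sum>k. cis (- (real k * X x)) * z ^ k) \<partial>M) = (herglotz M X z + measure M (space M)) / 2"
      using herglotz_kernel_integrable[OF assms z]
      by (simp add: sums_unique[OF s, symmetric] herglotz_def scaleR_conv_of_real)
    moreover have "(\<integral>x. cis (- (real k * X x)) * z ^ k \<partial>M) = c k * (z - 0) ^ k" for k
      by (simp add: c_def)
    ultimately show ?thesis by (simp only:)
  qed
  hence "(\<lambda>z. (herglotz M X z + measure M (space M)) / 2) holomorphic_on ball 0 1" by (rule power_series_holomorphic)
  hence "(\<lambda>z. 2 * ((herglotz M X z + measure M (space M)) / 2) - measure M (space M)) holomorphic_on ball 0 1"
    by (rule holomorphic_on_diff[OF holomorphic_on_mult[OF holomorphic_on_const] holomorphic_on_const])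
  thus ?thesis by (simp add: add_divide_distrib)
qed

end

subsection \<open>The Cantor maps\<close>

definition dyadic_floor :: "nat \<Rightarrow> real \<Rightarrow> real" where
  "dyadic_floor j x = of_int \<lfloor>2 ^ j * x\<rfloor> / 2 ^ j"

text \<open>The weight of level \<open>j = n + i\<close>, equal to \<open>n/j - n/(j+1)\<close> for
  \<open>n > 0\<close>. The weights telescope to total 1, and the levels from
  \<open>J \<ge> n\<close> on have weight \<open>n/J\<close>; this \<open>1/J\<close> is the source
  of the logarithm in \<open>lam\<close>.\<close>

definition cantor_weight :: "nat \<Rightarrow> nat \<Rightarrow> real" where
  "cantor_weight n i = real n / (real (n + i) * real (n + i + 1))"

text \<open>A weighted average of the binary truncations of \<open>x\<close> at levels
  \<open>n\<close> and beyond. It jumps at dyadic points and contracts inside dyadic intervals, so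
  its range is of Cantor type.\<close>

definition cantor_map :: "nat \<Rightarrow> real \<Rightarrow> real" where
  "cantor_map n x = (\<Sum>i. cantor_weight n i * dyadic_floor (n + i) x)"

lemma dyadic_floor_bounds: "dyadic_floor j x \<le> x" "x - 1 / 2 ^ j < dyadic_floor j x"
proof -
  have f: "of_int \<lfloor>2 ^ j * x\<rfloor> \<le> 2 ^ j * x" "2 ^ j * x - 1 < of_int \<lfloor>2 ^ j * x\<rfloor>" by linarith+
  show "dyadic_floor j x \<le> x" using f by (simp add: dyadic_floor_def field_simps)
  have "x - 1 / 2 ^ j = (2 ^ j * x - 1) / 2 ^ j" by (simp add: field_simps)
  also have "\<dots> < dyadic_floor j x" unfolding dyadic_floor_def using f by (intro divide_strict_right_mono) auto
  finally show "x - 1 / 2 ^ j < dyadic_floor j x" .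
qed

lemma dyadic_floor_mono: "x \<le> y \<Longrightarrow> dyadic_floor j x \<le> dyadic_floor j y"
  unfolding dyadic_floor_def by (intro divide_right_mono) (auto intro!: floor_mono)

lemma dyadic_floor_nonneg: "0 \<le> x \<Longrightarrow> 0 \<le> dyadic_floor j x"
  by (simp add: dyadic_floor_def)

text \<open>The coarser integer part is the finer one divided by \<open>2^(J - j)\<close> with the
  remainder dropped.\<close>

lemma dyadic_floor_eq_coarser:
  assumes "\<lfloor>2 ^ J * x\<rfloor> = \<lfloor>2 ^ J * y\<rfloor>" "j \<le> J"
  shows "dyadic_floor j x = dyadic_floor j y"
proof -
  have "\<lfloor>2 ^ j * x\<rfloor> = \<lfloor>2 ^ J * x\<rfloor> div 2 ^ (J - j)" for x :: real
  proof -
    have "2 ^ j * x = 2 ^ J * x / real_of_int (2 ^ (J - j))"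
    proof -
      have "(2::real) ^ J = 2 ^ j * 2 ^ (J - j)" using assms(2) by (simp flip: power_add)
      thus ?thesis by simp
    qed
    thus ?thesis using floor_divide_real_eq_div[of "2 ^ (J - j)" "2 ^ J * x"] by simp
  qed
  thus ?thesis using assms(1) by (simp add: dyadic_floor_def)
qed

lemma cantor_weight_nonneg: "0 \<le> cantor_weight n i"
  by (simp add: cantor_weight_def)

lemma cantor_weight_tail:
  assumes "0 < n"
  shows "(\<lambda>i. cantor_weight n (i + k)) sums (real n / real (n + k))"
proof -
  have "(\<lambda>i. real n * inverse (real (i + (n + k)))) \<longlonglongrightarrow> real n * 0"
    by (intro tendsto_mult tendsto_const LIMSEQ_ignore_initial_segment[OF lim_inverse_n])
  hence "(\<lambda>i. real n / real (n + k + i)) \<longlonglongrightarrow> 0" by (simp add: field_simps)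
  from telescope_sums'[OF this]
  have "(\<lambda>i. real n / real (n + k + i) - real n / real (n + k + Suc i)) sums (real n / real (n + k))" by simp
  moreover have "real n / real (n + k + i) - real n / real (n + k + Suc i) = cantor_weight n (i + k)" for i
  proof -
    have "real (n + k + i) > 0" using assms by simp
    thus ?thesis unfolding cantor_weight_def by (simp add: divide_simps) (simp add: algebra_simps)
  qed
  ultimately show ?thesis by simp
qed

lemma cantor_map_summable:
  assumes "0 < n"
  shows "summable (\<lambda>i. cantor_weight n i * dyadic_floor (n + i) x)"
proof (rule summable_comparison_test)
  have "norm (cantor_weight n i * dyadic_floor (n + i) x) \<le> cantor_weight n i * (\<bar>x\<bar> + 1)" for i
  proof -
    have "1 / 2 ^ (n + i) \<le> (1::real)" by simp
    hence "\<bar>dyadic_floor (n + i) x\<bar> \<le> \<bar>x\<bar> + 1" using dyadic_floor_bounds[where j="n + i" and x=x] by linarith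
    thus ?thesis using cantor_weight_nonneg[of n i] by (simp add: abs_mult mult_left_mono)
  qed
  thus "\<exists>N. \<forall>i\<ge>N. norm (cantor_weight n i * dyadic_floor (n + i) x) \<le> cantor_weight n i * (\<bar>x\<bar> + 1)" by blast
  show "summable (\<lambda>i. cantor_weight n i * (\<bar>x\<bar> + 1))"
    using cantor_weight_tail[OF assms, of 0] by (intro summable_mult2) (simp add: sums_iff)
qed

lemma cantor_map_bounds:
  assumes "0 < n" "0 \<le> x" "x < 1"
  shows "0 \<le> cantor_map n x" "cantor_map n x \<le> 1"
proof -
  note s = cantor_map_summable[OF assms(1), of x]
  show "0 \<le> cantor_map n x" unfolding cantor_map_def
    by (intro suminf_nonneg s mult_nonneg_nonneg cantor_weight_nonneg dyadic_floor_nonneg assms)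
  have w: "cantor_weight n sums 1" using cantor_weight_tail[OF assms(1), of 0] assms by simp
  have "cantor_map n x \<le> suminf (cantor_weight n)" unfolding cantor_map_def
  proof (rule suminf_le[OF _ s])
    fix i have "dyadic_floor (n + i) x \<le> 1" using dyadic_floor_bounds[where j="n + i" and x=x] assms by linarith
    thus "cantor_weight n i * dyadic_floor (n + i) x \<le> cantor_weight n i"
      using cantor_weight_nonneg[of n i] by (simp add: mult_left_le)
  qed (use w in \<open>simp add: sums_iff\<close>)
  thus "cantor_map n x \<le> 1" using w by (simp add: sums_iff)
qed

lemma cantor_map_measurable [measurable]: "cantor_map n \<in> borel_measurable borel"
  unfolding cantor_map_def dyadic_floor_def by measurable

lemma cantor_map_diff:
  assumes "0 < n"
  shows "(\<lambda>i. cantor_weight n i * (dyadic_floor (n + i) y - dyadic_floor (n + i) x)) sums (cantor_map n y - cantor_map n x)"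
  using sums_diff[OF summable_sums[OF cantor_map_summable[OF assms, of y]] summable_sums[OF cantor_map_summable[OF assms, of x]]]
  by (simp add: cantor_map_def right_diff_distrib)

lemma cantor_weight_truncated:
  assumes "0 < n"
  shows "(\<lambda>i. if i < k then 0 else cantor_weight n i * a) sums (real n / real (n + k) * a)"
proof -
  have "(\<lambda>i. (if i + k < k then 0 else cantor_weight n (i + k) * a)) sums (real n / real (n + k) * a)"
    using sums_mult2[OF cantor_weight_tail[OF assms, of k], of a] by simp
  thus ?thesis by (subst (asm) sums_iff_shift) simp
qed

text \<open>At levels above \<open>m\<close> the truncation error is at most half of
  \<open>y - x\<close>, so the truncations differ by at least the other half; lower levels
  contribute nonnegatively by monotonicity. The factor in front is the total weight of the levels
  used.\<close>

lemma cantor_map_expansion: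
  assumes n: "0 < n" and xy: "1 / 2 ^ m \<le> y - x"
  shows "real n / real (max n (m + 1)) * ((y - x) / 2) \<le> cantor_map n y - cantor_map n x"
proof -
  \<comment> \<open>Subtraction on naturals stops at 0, which is why \<open>max n (m + 1)\<close>
    appears.\<close>
  define k where "k = m + 1 - n"
  have nk: "n + k = max n (m + 1)" by (auto simp: k_def)
  have "0 < y - x" using xy by (rule less_le_trans[rotated]) simp
  have "(if i < k then 0 else cantor_weight n i * ((y - x) / 2)) \<le> cantor_weight n i * (dyadic_floor (n + i) y - dyadic_floor (n + i) x)" for i
  proof (cases "i < k")
    case True
    thus ?thesis using \<open>0 < y - x\<close> dyadic_floor_mono[of x y "n + i"] by (simp add: cantor_weight_nonneg)
  next
    case False
    have "(2::real) ^ Suc m \<le> 2 ^ (n + i)" using False by (intro power_increasing) (auto simp: k_def)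
    hence "1 / 2 ^ (n + i) \<le> 1 / (2::real) ^ Suc m" by (intro divide_left_mono) auto
    also have "\<dots> \<le> (y - x) / 2" using xy by simp
    finally have e: "1 / 2 ^ (n + i) \<le> (y - x) / 2" .
    have "(y - x) / 2 = (y - x) - (y - x) / 2" by (simp add: field_simps)
    also have "\<dots> \<le> (y - x) - 1 / 2 ^ (n + i)" using e by (intro diff_left_mono)
    also have "\<dots> \<le> dyadic_floor (n + i) y - dyadic_floor (n + i) x"
      using dyadic_floor_bounds[where j="n + i" and x=y] dyadic_floor_bounds[where j="n + i" and x=x] by linarith
    finally have "(y - x) / 2 \<le> dyadic_floor (n + i) y - dyadic_floor (n + i) x" .
    from mult_left_mono[OF this cantor_weight_nonneg[of n i]] False show ?thesis by simp
  qed
  from sums_le[OF this cantor_weight_truncated[OF n] cantor_map_diff[OF n]] show ?thesis by (simp only: nk)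
qed

lemma cantor_map_less:
  assumes "0 < n" "x < y"
  shows "cantor_map n x < cantor_map n y"
proof -
  obtain m where m: "(1/2) ^ m < y - x" using real_arch_pow_inv[of "y - x" "1/2"] assms by auto
  have "0 < real n / real (max n (m + 1)) * ((y - x) / 2)" using assms by simp
  also have "\<dots> \<le> cantor_map n y - cantor_map n x"
    using m by (intro cantor_map_expansion assms) (simp add: power_one_over)
  finally show ?thesis by simp
qed

text \<open>Points in the same dyadic interval of level \<open>J\<close> agree in all truncations up
  to \<open>J\<close>. Only the levels from \<open>J + 1\<close> on, of total weight
  \<open>n / (J + 1)\<close>, can separate their images, each by at most
  \<open>2 / 2^J\<close>.\<close>

lemma cantor_map_cylinder:
  assumes n: "0 < n" "n \<le> J" and eq: "\<lfloor>2 ^ J * x\<rfloor> = \<lfloor>2 ^ J * y\<rfloor>"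
  shows "\<bar>cantor_map n y - cantor_map n x\<bar> \<le> 2 * real n / (real (J + 1) * 2 ^ J)"
proof -
  define k where "k = J + 1 - n"
  have nk: "n + k = J + 1" using n by (simp add: k_def)
  have xy: "\<bar>y - x\<bar> \<le> 1 / 2 ^ J"
    using dyadic_floor_bounds[where j=J and x=x] dyadic_floor_bounds[where j=J and x=y] dyadic_floor_eq_coarser[OF eq order_refl] by linarith
  define b where "b i = (if i < k then 0 else cantor_weight n i * (2 / 2 ^ J))" for i
  have le: "\<bar>cantor_weight n i * (dyadic_floor (n + i) y - dyadic_floor (n + i) x)\<bar> \<le> b i" for i
  proof (cases "i < k")
    case True
    thus ?thesis using dyadic_floor_eq_coarser[OF eq, of "n + i"] nk by (simp add: b_def)
  next
    case False
    have "(2::real) ^ J \<le> 2 ^ (n + i)" using False by (intro power_increasing) (auto simp: k_def)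
    hence "1 / 2 ^ (n + i) \<le> 1 / (2::real) ^ J" by (intro divide_left_mono) auto
    hence "\<bar>dyadic_floor (n + i) y - dyadic_floor (n + i) x\<bar> \<le> 2 / 2 ^ J"
      using dyadic_floor_bounds[where j="n + i" and x=y] dyadic_floor_bounds[where j="n + i" and x=x] xy by linarith
    from mult_left_mono[OF this cantor_weight_nonneg[of n i]] False show ?thesis
      by (simp add: b_def abs_mult cantor_weight_nonneg)
  qed
  have b: "b sums (real n / real (n + k) * (2 / 2 ^ J))" unfolding b_def by (rule cantor_weight_truncated[OF n(1)])
  have "cantor_map n y - cantor_map n x \<le> real n / real (n + k) * (2 / 2 ^ J)"
    by (rule sums_le[OF _ cantor_map_diff[OF n(1)] b]) (use le in \<open>auto simp: abs_le_iff\<close>)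
  moreover have "- (cantor_map n y - cantor_map n x) \<le> real n / real (n + k) * (2 / 2 ^ J)"
    by (rule sums_le[OF _ sums_minus[OF cantor_map_diff[OF n(1)]] b]) (use le in \<open>auto simp: abs_le_iff\<close>)
  ultimately show ?thesis by (simp only: nk) (simp add: abs_le_iff mult.commute)
qed

text \<open>Take \<open>m\<close> to be \<open>- log 2 \<delta>\<close> rounded up;
  \<open>ln 2 \<ge> 1/2\<close> converts to natural logarithms.\<close>

lemma dyadic_scale:
  assumes "0 < \<delta>" "\<delta> \<le> 1"
  obtains m where "1 / 2 ^ m \<le> \<delta>" "real (m + 1) \<le> 2 * (1 - ln \<delta>)"
proof
  define m where "m = nat \<lceil>- log 2 \<delta>\<rceil>"
  have l: "log 2 \<delta> \<le> 0" using assms by simp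
  have m: "- log 2 \<delta> \<le> real m" "real m < - log 2 \<delta> + 1" using l unfolding m_def by linarith+
  have "1 / 2 ^ m = 2 powr (- real m)" by (simp add: powr_minus powr_realpow field_simps)
  also have "\<dots> \<le> 2 powr (log 2 \<delta>)" using m by (intro powr_mono) auto
  also have "\<dots> = \<delta>" using assms by simp
  finally show "1 / 2 ^ m \<le> \<delta>" .
  have "ln (2::real) \<ge> 1/2" using ln_2_less_1 ln2_ge_two_thirds by linarith
  hence "- ln \<delta> / ln 2 \<le> - ln \<delta> / (1/2)" using assms by (intro divide_left_mono) auto
  thus "real (m + 1) \<le> 2 * (1 - ln \<delta>)" using m by (simp add: log_def)
qed

subsection \<open>Herglotz transforms of the Cantor measures\<close>

abbreviation unit_interval :: "real measure" where
  "unit_interval \<equiv> restrict_space lborel {0..<1}"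

lemma finite_measure_unit_interval: "finite_measure unit_interval"
  by (intro finite_measureI) (simp add: space_restrict_space emeasure_restrict_space)

lemma measure_unit_interval: "measure unit_interval (space unit_interval) = 1"
  by (simp add: space_restrict_space measure_restrict_space)

lemma cantor_map_measurable_unit: "cantor_map n \<in> borel_measurable unit_interval"
  by (intro measurable_restrict_space1) simp

definition cantor_herglotz :: "nat \<Rightarrow> complex \<Rightarrow> complex" where
  "cantor_herglotz n = herglotz unit_interval (cantor_map n)"

lemma cantor_herglotz_holomorphic: "cantor_herglotz n holomorphic_on ball 0 1"
  unfolding cantor_herglotz_def
  by (intro finite_measure.herglotz_holomorphic finite_measure_unit_interval cantor_map_measurable_unit)

lemma norm_cantor_herglotz_le: "norm z < 1 \<Longrightarrow> norm (cantor_herglotz n z) \<le> 2 / (1 - norm z)"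
  using finite_measure.norm_herglotz_le[OF finite_measure_unit_interval cantor_map_measurable_unit, of z n]
  unfolding measure_unit_interval by (simp add: cantor_herglotz_def)

lemma Re_cantor_herglotz:
  assumes "norm z < 1"
  shows "ennreal (Re (cantor_herglotz n z)) =
      ennreal (1 - (norm z)\<^sup>2) * (\<integral>\<^sup>+x. ennreal (1 / (norm (cis (cantor_map n x) - z))\<^sup>2) \<partial>unit_interval)"
    and "0 \<le> Re (cantor_herglotz n z)"
  unfolding cantor_herglotz_def
  by (intro finite_measure.Re_herglotz finite_measure_unit_interval cantor_map_measurable_unit assms)+

text \<open>The values are used directly as angles. They lie in an interval of length 1, below
  \<open>pi\<close>, so nothing wraps around the circle.\<close>

lemma cantor_map_diff_le_chord:
  assumes n: "0 < n" and xy: "x \<in> {0..<1}" "y \<in> {0..<1}"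
  shows "cantor_map n y - cantor_map n x \<le> 2 * norm (cis (cantor_map n y) - cis (cantor_map n x))"
proof -
  have "\<bar>cantor_map n y - cantor_map n x\<bar> \<le> 1"
    using cantor_map_bounds[OF n, of x] cantor_map_bounds[OF n, of y] xy by auto
  hence "\<bar>cantor_map n y - cantor_map n x\<bar> \<le> pi" using pi_gt3 by linarith
  from abs_le_chord[OF this] show ?thesis by (simp add: chord_eq[of "cantor_map n y"])
qed

text \<open>The interval of radius \<open>\<tau>\<close> about any point of \<open>A\<close> works.
  Passing to a measurable superset avoids proving that \<open>A\<close> itself is
  measurable.\<close>

lemma emeasure_unit_interval_diameter_le:
  assumes "A \<subseteq> {0..<1}" "0 \<le> \<tau>" "\<And>x y. x \<in> A \<Longrightarrow> y \<in> A \<Longrightarrow> x < y \<Longrightarrow> y - x \<le> \<tau>"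
  obtains B where "B \<in> sets lborel" "A \<subseteq> B" "emeasure lborel B \<le> ennreal (2 * \<tau>)"
proof (cases "A = {}")
  case True
  show ?thesis by (rule that[of "{}"]) (auto simp: True)
next
  case False
  then obtain a where a: "a \<in> A" by auto
  have "x \<in> {a - \<tau>..a + \<tau>}" if "x \<in> A" for x
    using assms(2) assms(3)[OF a that] assms(3)[OF that a] by (cases x a rule: linorder_cases) auto
  moreover have "emeasure lborel {a - \<tau>..a + \<tau>} \<le> ennreal (2 * \<tau>)"
    using assms(2) by simp
  ultimately show ?thesis by (intro that[of "{a - \<tau>..a + \<tau>}"]) auto
qed

text \<open>By the expansion estimate, a disc of radius \<open>h \<ge> \<delta>\<close> pulls back
  to a set of diameter \<open>O(h * L)\<close>, so the image measure satisfies the hypothesis of the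
  dyadic lemma with \<open>K = 0\<close>. The constant does not depend on \<open>n\<close>, which
  allows summation over \<open>n\<close> later.\<close>

lemma Re_cantor_herglotz_le:
  assumes n: "0 < n" and z: "norm z < 1"
  shows "Re (cantor_herglotz n z) \<le> 384 * (1 - ln (1 - norm z))"
proof -
  define \<delta> where "\<delta> = 1 - norm z"
  have \<delta>: "0 < \<delta>" "\<delta> \<le> 1" using z by (auto simp: \<delta>_def)
  define L where "L = 1 - ln \<delta>"
  have L: "1 \<le> L" using \<delta> by (simp add: L_def)
  define g where "g x = norm (cis (cantor_map n x) - z)" for x
  obtain m where m: "1 / 2 ^ m \<le> \<delta>" "real (m + 1) \<le> 2 * L"
    using dyadic_scale[OF \<delta>] by (auto simp: L_def)
  have mass: "emeasure unit_interval {x \<in> space unit_interval. g x \<le> 2 ^ Suc k * \<delta>} \<le> ennreal (64 * L * 2 ^ k * \<delta>)" for k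
  proof -
    define A where "A = {x \<in> {0..<1}. g x \<le> 2 ^ Suc k * \<delta>}"
    have diam: "y - x \<le> 32 * L * 2 ^ k * \<delta>" if xy: "x \<in> A" "y \<in> A" "x < y" for x y
    proof (cases "1 / 2 ^ m \<le> y - x")
      case True
      have "norm (cis (cantor_map n y) - cis (cantor_map n x)) \<le> g y + g x"
        using norm_triangle_ineq4[of "cis (cantor_map n y) - z" "cis (cantor_map n x) - z"] by (simp add: g_def)
      also have "\<dots> \<le> 4 * 2 ^ k * \<delta>" using xy by (simp add: A_def)
      finally have "cantor_map n y - cantor_map n x \<le> 8 * 2 ^ k * \<delta>"
        using cantor_map_diff_le_chord[OF n, of x y] xy by (simp add: A_def)
      \<comment> \<open>Discards the favourable factor \<open>n\<close> in favour of a bound uniform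
        in \<open>n\<close>.\<close>
      moreover have "real n / real (max n (m + 1)) \<ge> 1 / real (m + 1)"
      proof (cases "n \<le> m + 1")
        case True
        thus ?thesis using n by (auto simp: max_def intro!: divide_right_mono)
      qed (use n in \<open>simp add: max_def\<close>)
      hence "1 / real (m + 1) * ((y - x) / 2) \<le> real n / real (max n (m + 1)) * ((y - x) / 2)"
        using xy by (intro mult_right_mono) auto
      moreover note cantor_map_expansion[OF n True]
      ultimately have "1 / real (m + 1) * ((y - x) / 2) \<le> 8 * 2 ^ k * \<delta>" by linarith
      hence "y - x \<le> 16 * (2 ^ k * \<delta>) * real (m + 1)" by (simp add: field_simps)
      also have "\<dots> \<le> 16 * (2 ^ k * \<delta>) * (2 * L)" using m \<delta> by (intro mult_left_mono) auto
      finally show ?thesis by (simp add: mult_ac)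
    next
      case False
      hence "y - x \<le> 1 * \<delta>" using m by simp
      also have "\<dots> \<le> 32 * L * 2 ^ k * \<delta>"
        using L mult_mono[of 1 "32 * L" 1 "(2::real) ^ k"] \<delta> by (intro mult_right_mono) auto
      finally show ?thesis .
    qed
    obtain B where B: "B \<in> sets lborel" "A \<subseteq> B" "emeasure lborel B \<le> ennreal (2 * (32 * L * 2 ^ k * \<delta>))"
      by (rule emeasure_unit_interval_diameter_le[of A "32 * L * 2 ^ k * \<delta>"]) (use diam L \<delta> in \<open>auto simp: A_def\<close>)
    have "{x \<in> space unit_interval. g x \<le> 2 ^ Suc k * \<delta>} = A" by (auto simp: A_def space_restrict_space)
    moreover have "emeasure unit_interval A = emeasure lborel A"
      by (intro emeasure_restrict_space) (auto simp: A_def)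
    moreover have "emeasure lborel A \<le> emeasure lborel B" using B by (intro emeasure_mono)
    moreover have "2 * (32 * L * 2 ^ k * \<delta>) = 64 * L * 2 ^ k * \<delta>" by simp
    ultimately show ?thesis using B(3) by (simp only:)
  qed
  have "(\<integral>\<^sup>+x. ennreal (1 / (g x)\<^sup>2) \<partial>unit_interval)
    \<le> ennreal (1 / \<delta>\<^sup>2) * emeasure unit_interval {x \<in> space unit_interval. g x \<le> 2 ^ 0 * \<delta>} + ennreal (2 * (64 * L) / (2 ^ 0 * \<delta>))"
  proof (rule nn_integral_inverse_square_dyadic)
    show "g \<in> borel_measurable unit_interval"
      unfolding g_def using cantor_map_measurable_unit[of n] by measurable
    show "\<delta> \<le> g x" for x unfolding \<delta>_def g_def by (rule norm_cis_diff_ge)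
  qed (use \<delta> L mass in auto)
  \<comment> \<open>The mass bound starts at radius \<open>2 * \<delta>\<close>, so the innermost
    disc is enlarged to that radius. The total constant is 64 + 128 = 192.\<close>
  also have "emeasure unit_interval {x \<in> space unit_interval. g x \<le> 2 ^ 0 * \<delta>}
     \<le> emeasure unit_interval {x \<in> space unit_interval. g x \<le> 2 ^ Suc 0 * \<delta>}"
  proof (intro emeasure_mono)
    have [measurable]: "g \<in> borel_measurable unit_interval"
      unfolding g_def using cantor_map_measurable_unit[of n] by measurable
    show "{x \<in> space unit_interval. g x \<le> 2 ^ Suc 0 * \<delta>} \<in> sets unit_interval" by measurable
  qed (use \<delta> in auto)
  also have "\<dots> \<le> ennreal (64 * L * 2 ^ 0 * \<delta>)" by (rule mass)
  also have "ennreal (1 / \<delta>\<^sup>2) * ennreal (64 * L * 2 ^ 0 * \<delta>) + ennreal (2 * (64 * L) / (2 ^ 0 * \<delta>))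
     = ennreal (1 / \<delta>\<^sup>2 * (64 * L * 2 ^ 0 * \<delta>) + 2 * (64 * L) / (2 ^ 0 * \<delta>))"
    using \<delta> L by (subst ennreal_mult[symmetric], simp, simp, subst ennreal_plus[symmetric]) auto
  also have "1 / \<delta>\<^sup>2 * (64 * L * 2 ^ 0 * \<delta>) + 2 * (64 * L) / (2 ^ 0 * \<delta>) = 192 * L / \<delta>"
    using \<delta> by (simp add: field_simps power2_eq_square)
  finally have int: "(\<integral>\<^sup>+x. ennreal (1 / (g x)\<^sup>2) \<partial>unit_interval) \<le> ennreal (192 * L / \<delta>)"
    by (simp add: add_right_mono mult_left_mono)
  have q: "1 - (norm z)\<^sup>2 \<le> 2 * \<delta>" "0 \<le> 1 - (norm z)\<^sup>2"
  proof -
    have "1 - (norm z)\<^sup>2 = \<delta> * (1 + norm z)" by (simp add: \<delta>_def power2_eq_square algebra_simps)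
    also have "\<dots> \<le> \<delta> * 2" using z \<delta> by (intro mult_left_mono) auto
    finally show "1 - (norm z)\<^sup>2 \<le> 2 * \<delta>" by simp
    show "0 \<le> 1 - (norm z)\<^sup>2" using z by (simp add: power_le_one)
  qed
  have "ennreal (Re (cantor_herglotz n z)) \<le> ennreal (2 * \<delta>) * ennreal (192 * L / \<delta>)"
    unfolding Re_cantor_herglotz(1)[OF z] using int q unfolding g_def
    by (intro mult_mono) (auto intro: ennreal_leI)
  also have "\<dots> = ennreal (384 * L)"
    using \<delta> L by (subst ennreal_mult[symmetric]) auto
  finally show ?thesis using L by (simp add: L_def \<delta>_def)
qed

text \<open>The dyadic interval of level \<open>J\<close> around \<open>x\<close> has length
  \<open>2^-J\<close>, and its image stays within \<open>2 * n * h J\<close> of the image of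
  \<open>x\<close>. At the first \<open>J\<close> with \<open>h J \<le> \<delta>\<close> the image
  is within \<open>(1 + 2 * n) * \<delta>\<close> of \<open>z\<close>, while the mass is of order at
  least \<open>\<delta> * J\<close>, where \<open>J\<close> is at least half of
  \<open>- ln \<delta>\<close>. Its contribution to the Poisson integral already suffices.\<close>

lemma Re_cantor_herglotz_ge:
  assumes n: "0 < n" and x: "x \<in> {0..<1}" and \<delta>: "0 < \<delta>" "2 * real n \<le> - ln \<delta>"
  shows "- ln \<delta> / (4 * (1 + 2 * real n)\<^sup>2) \<le> Re (cantor_herglotz n (of_real (1 - \<delta>) * cis (cantor_map n x)))"
proof -
  have \<delta>1: "\<delta> < 1"
  proof -
    have "ln \<delta> < 0" using n \<delta>(2) by linarith
    thus ?thesis using \<delta>(1) by simp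
  qed
  define z where "z = of_real (1 - \<delta>) * cis (cantor_map n x)"
  have nz: "norm z = 1 - \<delta>" using \<delta>1 by (simp add: z_def norm_mult del: of_real_diff)
  define h where "h J = 1 / (real (J + 1) * 2 ^ J)" for J
  have "\<exists>J. h J \<le> \<delta>"
  proof -
    obtain J where J: "(1/2) ^ J < \<delta>" using real_arch_pow_inv[of \<delta> "1/2"] \<delta> by auto
    have "h J \<le> 1 / 2 ^ J" unfolding h_def by (intro divide_left_mono) auto
    thus ?thesis using J by (intro exI[of _ J]) (simp add: power_one_over)
  qed
  define J where "J = (LEAST J. h J \<le> \<delta>)"
  have J: "h J \<le> \<delta>" unfolding J_def by (rule LeastI_ex) fact
  have "J \<noteq> 0" 
  proof
    assume "J = 0"
    with J have "h 0 \<le> \<delta>" by simp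
    thus False using \<delta>1 by (simp add: h_def)
  qed
  then obtain i where i: "J = Suc i" using not0_implies_Suc by auto
  have "\<not> h i \<le> \<delta>" using not_less_Least[of i "\<lambda>J. h J \<le> \<delta>"] by (simp add: J_def[symmetric] i)
  hence "\<delta> * (real (i + 1) * 2 ^ i) \<le> 1" by (simp add: h_def pos_less_divide_eq not_le)
  \<comment> \<open>Minimality of \<open>J\<close>, read at the previous level
    \<open>i = J - 1\<close>.\<close>
  hence mass: "\<delta> * real J / 2 \<le> 1 / 2 ^ J" by (simp add: i pos_le_divide_eq mult_ac)
  \<comment> \<open>From \<open>J + 1 \<le> 2^J\<close> one gets \<open>\<delta> \<ge> 4^-J\<close>,
    and \<open>ln 4 \<le> 2\<close>.\<close>
  have lnJ: "- ln \<delta> \<le> 2 * real J"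
  proof -
    have "real (J + 1) \<le> 2 ^ J"
    proof -
      have "J + 1 \<le> 2 ^ J" using less_exp[of J] by linarith
      hence "real (J + 1) \<le> real (2 ^ J)" by (rule of_nat_mono)
      thus ?thesis by simp
    qed
    hence "real (J + 1) * 2 ^ J \<le> 2 ^ J * 2 ^ J" by (intro mult_right_mono) auto
    hence "1 / (2 ^ J * 2 ^ J) \<le> h J" unfolding h_def by (intro divide_left_mono) auto
    hence "1 / 4 ^ J \<le> \<delta>" using J by (simp add: power_mult_distrib[symmetric])
    hence "ln (1 / 4 ^ J) \<le> ln \<delta>" using \<delta> by (subst ln_le_cancel_iff) auto
    hence "- ln \<delta> \<le> real J * ln 4" by (simp add: ln_div ln_realpow)
    moreover have "ln (4::real) = 2 * ln 2" using ln_realpow[of 2 2] by simp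
    hence "ln (4::real) \<le> 2" using ln_2_less_1 by simp
    hence "real J * ln 4 \<le> real J * 2" by (intro mult_left_mono) auto
    ultimately show ?thesis by linarith
  qed
  hence nJ: "n \<le> J" using \<delta>(2) by linarith
  define q where "q = \<lfloor>2 ^ J * x\<rfloor>"
  define I where "I = {of_int q / 2 ^ J..<(of_int q + 1) / (2::real) ^ J}"
  have I: "\<lfloor>2 ^ J * y\<rfloor> = q" if "y \<in> I" for y
    using that by (intro floor_unique) (auto simp: I_def field_simps)
  have IU: "I \<subseteq> {0..<1}"
  proof -
    have "0 \<le> q" using x by (simp add: q_def)
    have "2 ^ J * x < 2 ^ J" using x by simp
    hence "q < 2 ^ J" unfolding q_def by (simp add: floor_less_iff)
    hence "q + 1 \<le> 2 ^ J" by simp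
    hence "real_of_int (q + 1) \<le> real_of_int (2 ^ J)" by (rule of_int_le_iff[THEN iffD2])
    hence "(of_int q + 1) / (2::real) ^ J \<le> 1" by simp
    moreover have "0 \<le> of_int q / (2::real) ^ J" using \<open>0 \<le> q\<close> by simp
    ultimately show ?thesis unfolding I_def by (auto intro: order_trans less_le_trans)
  qed
  have meas: "emeasure unit_interval I = ennreal (1 / 2 ^ J)"
  proof -
    have "emeasure unit_interval I = emeasure lborel I" using IU by (intro emeasure_restrict_space) auto
    also have "\<dots> = ennreal ((of_int q + 1) / 2 ^ J - of_int q / 2 ^ J)"
      unfolding I_def by (intro emeasure_lborel_Ico divide_right_mono) auto
    finally show ?thesis by (simp add: diff_divide_distrib[symmetric])
  qed
  define D where "D = (1 + 2 * real n) * \<delta>"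
  have D: "0 < D" using \<delta> by (simp add: D_def)
  have near: "norm (cis (cantor_map n y) - z) \<le> D" if "y \<in> I" for y
  proof -
    have "\<bar>cantor_map n y - cantor_map n x\<bar> \<le> 2 * real n / (real (J + 1) * 2 ^ J)"
      using I[OF that] by (intro cantor_map_cylinder n nJ) (simp add: q_def)
    also have "\<dots> = 2 * real n * h J" by (simp add: h_def)
    also have "\<dots> \<le> 2 * real n * \<delta>" using J by (intro mult_left_mono) auto
    finally have "norm (cis (cantor_map n y) - cis (cantor_map n x)) \<le> 2 * real n * \<delta>"
      using chord_le order_trans by blast
    moreover have "cis (cantor_map n x) - z = of_real \<delta> * cis (cantor_map n x)" by (simp add: z_def algebra_simps)
    hence "norm (cis (cantor_map n x) - z) = \<delta>" using \<delta> by (simp add: norm_mult)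
    ultimately show ?thesis
      using norm_triangle_ineq[of "cis (cantor_map n y) - cis (cantor_map n x)" "cis (cantor_map n x) - z"]
      by (simp add: D_def algebra_simps)
  qed
  have p: "\<delta> \<le> 1 - (norm z)\<^sup>2" using \<delta> \<delta>1 mult_left_mono[of \<delta> 1 \<delta>] by (simp add: nz power2_eq_square algebra_simps)
  have "- ln \<delta> / (4 * (1 + 2 * real n)\<^sup>2) \<le> 2 * real J / (4 * (1 + 2 * real n)\<^sup>2)"
    using lnJ by (intro divide_right_mono) auto
  also have "\<dots> = (\<delta> / D\<^sup>2) * (\<delta> * real J / 2)"
    using \<delta> by (simp add: D_def power_mult_distrib) (simp add: power2_eq_square)
  also have "\<dots> \<le> (\<delta> / D\<^sup>2) * (1 / 2 ^ J)" using mass \<delta> by (intro mult_left_mono) auto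
  finally have "ennreal (- ln \<delta> / (4 * (1 + 2 * real n)\<^sup>2)) \<le> ennreal ((\<delta> / D\<^sup>2) * (1 / 2 ^ J))" by (rule ennreal_leI)
  also have "\<dots> = ennreal \<delta> * (ennreal (1 / D\<^sup>2) * emeasure unit_interval I)"
    unfolding meas using \<delta> by (simp add: ennreal_mult[symmetric])
  also have "\<dots> = ennreal \<delta> * (\<integral>\<^sup>+y. ennreal (1 / D\<^sup>2) * indicator I y \<partial>unit_interval)"
  proof (subst nn_integral_cmult_indicator)
    have "I \<in> sets borel" by (simp add: I_def)
    thus "I \<in> sets unit_interval" using IU by (auto simp: sets_restrict_space_iff)
  qed simp
  also have "\<dots> \<le> ennreal (1 - (norm z)\<^sup>2) * (\<integral>\<^sup>+y. ennreal (1 / (norm (cis (cantor_map n y) - z))\<^sup>2) \<partial>unit_interval)"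
  proof (intro mult_mono nn_integral_mono)
    fix y
    show "ennreal (1 / D\<^sup>2) * indicator I y \<le> ennreal (1 / (norm (cis (cantor_map n y) - z))\<^sup>2)"
    proof (cases "y \<in> I")
      case True
      \<comment> \<open>Positivity matters, since division by zero would yield 0 on the right-hand
        side.\<close>
      have "0 < norm (cis (cantor_map n y) - z)" using norm_cis_diff_ge[of z "cantor_map n y"] unfolding nz using \<delta> by linarith
      hence "1 / D\<^sup>2 \<le> 1 / (norm (cis (cantor_map n y) - z))\<^sup>2"
        using near[OF True] D by (intro divide_left_mono power_mono mult_pos_pos) auto
      thus ?thesis using True by (simp add: ennreal_leI)
    qed simp
  qed (use p in \<open>auto intro: ennreal_leI\<close>)
  also have "\<dots> = ennreal (Re (cantor_herglotz n z))"
    using \<delta> by (intro Re_cantor_herglotz(1)[symmetric]) (simp add: nz)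
  finally show ?thesis using Re_cantor_herglotz(2)[of z n] \<delta> unfolding z_def[symmetric]
    by (simp add: nz ennreal_le_iff)
qed

section \<open>Large Hausdorff measure of the Cantor sets\<close>

text \<open>A mass distribution argument: an arc of length \<open>d\<close> pulls back to a set of
  diameter at most \<open>16 / n * lam d\<close>, and the pullbacks of a cover must fill the unit
  interval. A single \<open>\<epsilon>\<close> suffices for a lower bound, and
  \<open>\<epsilon> = exp (- n)\<close> restricts to scales where \<open>- ln d\<close> exceeds
  \<open>n\<close>, so that the gain \<open>1/n\<close> is available.\<close>

lemma H_meas_cantor_ge:
  assumes n: "0 < n" and S: "cis ` cantor_map n ` {0..<1} \<subseteq> S"
  shows "ennreal (real n / 32) \<le> H_meas lam S"
proof -
  have "ennreal (real n / 32) \<le> (\<Sum>i. ennreal (lam (b i - a i)))"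
    if ab: "\<And>i. 0 \<le> b i - a i \<and> b i - a i < exp (- real n)" and cover: "S \<subseteq> (\<Union>i. cis ` {a i..b i})" for a b :: "nat \<Rightarrow> real"
  proof -
    define A where "A i = {x \<in> {0..<1}. cis (cantor_map n x) \<in> cis ` {a i..b i}}" for i
    define \<tau> where "\<tau> i = 16 / real n * lam (b i - a i)" for i
    have \<tau>: "0 \<le> \<tau> i" for i using ab[of i] by (simp add: \<tau>_def lam_def)
    have diam: "y - x \<le> \<tau> i" if xy: "x \<in> A i" "y \<in> A i" "x < y" for x y i
    proof -
      define d where "d = b i - a i"
      obtain s t where st: "s \<in> {a i..b i}" "t \<in> {a i..b i}" "cis (cantor_map n x) = cis s" "cis (cantor_map n y) = cis t"
        using xy unfolding A_def by blast
      have "norm (cis (cantor_map n y) - cis (cantor_map n x)) \<le> d"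
        using order_trans[OF chord_le[of t s], of d] st by (auto simp: d_def)
      hence le: "cantor_map n y - cantor_map n x \<le> 2 * d"
        using cantor_map_diff_le_chord[OF n, of x y] xy by (simp add: A_def)
      have "cantor_map n x < cantor_map n y" by (rule cantor_map_less[OF n xy(3)])
      hence d: "0 < d" using le by linarith
      have dn: "d < exp (- real n)" using ab[of i] by (simp add: d_def)
      have "ln d < - real n" using dn d by (metis ln_exp ln_less_cancel_iff exp_gt_zero)
      define l where "l = - ln d"
      have l: "real n \<le> l" using \<open>ln d < - real n\<close> by (simp add: l_def)
      have l1: "1 \<le> l" using l n by linarith
      have lam: "lam d = d * l" using l1 by (simp add: lam_def l_def)
      have "d \<le> 1" using dn by (rule less_imp_le[OF less_le_trans]) simp
      then obtain m where m: "1 / 2 ^ m \<le> d" "real (m + 1) \<le> 2 * (1 + l)"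
        using dyadic_scale[OF d] by (auto simp: l_def)
      have m4: "real (m + 1) \<le> 4 * l" using order_trans[OF m(2), of "4 * l"] l1 by simp
      show ?thesis
      proof (cases "1 / 2 ^ m \<le> y - x")
        case True
        from cantor_map_expansion[OF n this] le
        have "real n / real (max n (m + 1)) * ((y - x) / 2) \<le> 2 * d" by linarith
        hence "real n * (y - x) \<le> 4 * d * real (max n (m + 1))" using n by (simp add: field_simps)
        also have "\<dots> \<le> 4 * d * (4 * l)" using m4 l l1 d by (intro mult_left_mono) (auto simp: max_def)
        finally have "y - x \<le> 4 * d * (4 * l) / real n" using n by (simp add: field_simps)
        thus ?thesis by (simp add: \<tau>_def lam d_def[symmetric] mult_ac)
      next
        case False
        hence "y - x \<le> d" using m by linarith
        also have "\<dots> \<le> 16 / real n * (d * l)"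
        proof -
          have "real n * d \<le> 16 * (d * l)" using mult_left_mono[OF l, of d] d l1 by (simp add: mult_ac) 
          thus ?thesis using n by (simp add: field_simps)
        qed
        finally show ?thesis by (simp add: \<tau>_def lam d_def[symmetric])
      qed
    qed
    have "\<exists>B. B \<in> sets lborel \<and> A i \<subseteq> B \<and> emeasure lborel B \<le> ennreal (2 * \<tau> i)" for i
      by (rule emeasure_unit_interval_diameter_le[of "A i" "\<tau> i"]) (use \<tau> diam in \<open>auto simp: A_def\<close>)
    then obtain B where B: "\<And>i. B i \<in> sets lborel" "\<And>i. A i \<subseteq> B i" "\<And>i. emeasure lborel (B i) \<le> ennreal (2 * \<tau> i)"
      by metis
    have "{0..<1} \<subseteq> (\<Union>i. A i)"
    proof
      fix x :: real assume x: "x \<in> {0..<1}"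
      hence "cis (cantor_map n x) \<in> (\<Union>i. cis ` {a i..b i})" using S cover by blast
      thus "x \<in> (\<Union>i. A i)" using x unfolding A_def by blast
    qed
    hence sub: "{0..<1} \<subseteq> (\<Union>i. B i)" using B(2) by blast
    have "1 = emeasure lborel {0..<1::real}" by simp
    also have "\<dots> \<le> emeasure lborel (\<Union>i. B i)" using B(1) by (intro emeasure_mono sub) auto
    also have "\<dots> \<le> (\<Sum>i. emeasure lborel (B i))" using B(1) by (intro emeasure_subadditive_countably) auto
    also have "\<dots> \<le> (\<Sum>i. ennreal (32 / real n) * ennreal (lam (b i - a i)))"
    proof (intro suminf_le allI)
      fix i
      have "ennreal (2 * \<tau> i) = ennreal (32 / real n) * ennreal (lam (b i - a i))"
        using ab[of i] by (subst ennreal_mult[symmetric]) (auto simp: \<tau>_def lam_def)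
      thus "emeasure lborel (B i) \<le> ennreal (32 / real n) * ennreal (lam (b i - a i))" using B(3)[of i] by simp
    qed auto
    also have "\<dots> = ennreal (32 / real n) * (\<Sum>i. ennreal (lam (b i - a i)))" by simp
    finally have "ennreal (real n / 32) * 1 \<le> ennreal (real n / 32) * (ennreal (32 / real n) * (\<Sum>i. ennreal (lam (b i - a i))))"
      by (rule mult_left_mono) simp
    also have "\<dots> = (\<Sum>i. ennreal (lam (b i - a i)))"
      using n by (simp add: mult.assoc[symmetric] ennreal_mult[symmetric])
    finally show ?thesis by simp
  qed
  hence "ennreal (real n / 32) \<le> (INF ab\<in>{ab :: (nat \<Rightarrow> real) \<times> (nat \<Rightarrow> real).
        (\<forall>i. 0 \<le> snd ab i - fst ab i \<and> snd ab i - fst ab i < exp (- real n)) \<and>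
        S \<subseteq> (\<Union>i. cis ` {fst ab i..snd ab i})}. (\<Sum>i. ennreal (lam (snd ab i - fst ab i))))"
    by (intro INF_greatest) blast
  also have "\<dots> \<le> H_meas lam S" unfolding H_meas_def by (rule SUP_upper) simp
  finally show ?thesis .
qed

section \<open>Superposition of the Cantor measures and the function of (b)\<close>

text \<open>The weights \<open>(1/2)^n\<close> sum to 2, which doubles the uniform constant 384.
  Since all real parts are nonnegative, the sum dominates each single term. The index
  \<open>Suc n\<close> keeps the parameter of the Cantor map positive.\<close>

lemma weighted_cantor_herglotz:
  obtains F where "F holomorphic_on ball 0 1"
    "\<And>z. norm z < 1 \<Longrightarrow> 0 \<le> Re (F z)"
    "\<And>z. norm z < 1 \<Longrightarrow> Re (F z) \<le> 768 * (1 - ln (1 - norm z))"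
    "\<And>z n. norm z < 1 \<Longrightarrow> (1/2) ^ n * Re (cantor_herglotz (Suc n) z) \<le> Re (F z)"
proof -
  define f where "f n z = (1/2) ^ n * cantor_herglotz (Suc n) z" for n z
  obtain F where F: "\<forall>z\<in>ball 0 1. ((\<lambda>n. f n z) sums F z) \<and> F field_differentiable (at z)"
  proof (rule series_differentiable_comparison_complex[of "ball 0 1" f])
    fix n and z :: complex assume z: "z \<in> ball 0 1"
    have "f n holomorphic_on ball 0 1" unfolding f_def by (intro holomorphic_intros cantor_herglotz_holomorphic)
    thus "f n field_differentiable at z" using z by (simp add: holomorphic_on_imp_differentiable_at)
  next
    fix x :: complex assume "x \<in> ball 0 1"
    hence x: "norm x < 1" by simp
    \<comment> \<open>On the ball of radius \<open>d\<close> about \<open>x\<close> one still has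
      \<open>1 - norm y \<ge> d\<close>, which gives a majorant uniform in \<open>y\<close>.\<close>
    define d where "d = (1 - norm x) / 2"
    define h :: "nat \<Rightarrow> complex" where "h n = of_real ((1/2) ^ n * (2 / d))" for n
    have d: "0 < d" using x by (simp add: d_def)
    have "summable (\<lambda>n. (1/2::real) ^ n * (2 / d))" by (intro summable_mult2 summable_geometric) simp
    hence "summable h" unfolding h_def by (rule summable_of_real)
    moreover have "range h \<subseteq> \<real>\<^sub>\<ge>\<^sub>0" using d by (auto simp: h_def simp del: of_real_mult of_real_divide)
    moreover have "norm (f n y) \<le> norm (h n)" if "y \<in> ball x d \<inter> ball 0 1" for n y
    proof -
      have "norm y \<le> norm x + d" using that norm_triangle_ineq2[of y x] by (simp add: dist_norm norm_minus_commute)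
      hence "d \<le> 1 - norm y" using d_def x by (simp add: field_simps)
      hence "2 / (1 - norm y) \<le> 2 / d" using d by (intro divide_left_mono) auto
      moreover have "norm (cantor_herglotz (Suc n) y) \<le> 2 / (1 - norm y)" using that by (intro norm_cantor_herglotz_le) auto
      ultimately have "norm (cantor_herglotz (Suc n) y) \<le> 2 / d" by linarith
      hence "(1/2) ^ n * norm (cantor_herglotz (Suc n) y) \<le> (1/2) ^ n * (2 / d)" by (intro mult_left_mono) auto
      moreover have "norm (h n) = (1/2) ^ n * (2 / d)" unfolding h_def norm_of_real using d by simp
      moreover have "norm (f n y) = (1/2) ^ n * norm (cantor_herglotz (Suc n) y)" by (simp add: f_def norm_mult norm_power norm_divide)
      ultimately show ?thesis by simp
    qed
    ultimately show "\<exists>d (h :: nat \<Rightarrow> complex). 0 < d \<and> summable h \<and> range h \<subseteq> \<real>\<^sub>\<ge>\<^sub>0 \<and> (\<forall>\<^sub>F n in sequentially. \<forall>y\<in>ball x d \<inter> ball 0 1. norm (f n y) \<le> norm (h n))"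
      using d by (intro exI[of _ d] exI[of _ h]) auto
  qed (auto intro: that)
  have s: "(\<lambda>n. (1/2) ^ n * Re (cantor_herglotz (Suc n) z)) sums Re (F z)" if "norm z < 1" for z
  proof -
    have "(\<lambda>n. Re (f n z)) sums Re (F z)" using F that by (intro sums_Re) auto
    moreover have "f n z = of_real ((1/2) ^ n) * cantor_herglotz (Suc n) z" for n by (simp add: f_def)
    hence "Re (f n z) = (1/2) ^ n * Re (cantor_herglotz (Suc n) z)" for n by (simp del: of_real_power)
    ultimately show ?thesis by simp
  qed
  have nonneg: "0 \<le> (1/2) ^ n * Re (cantor_herglotz (Suc n) z)" if "norm z < 1" for n z
    using Re_cantor_herglotz(2)[OF that] by simp
  show thesis
  proof (rule that[of F])
    show "F holomorphic_on ball 0 1"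
      unfolding holomorphic_on_def using F by (auto intro: field_differentiable_at_within)
    fix z :: complex assume z: "norm z < 1"
    show "0 \<le> Re (F z)" using sums_le[OF nonneg[OF z] sums_zero s[OF z]] .
    have "(\<lambda>n. (1/2) ^ n * (384 * (1 - ln (1 - norm z)))) sums (2 * (384 * (1 - ln (1 - norm z))))"
      using sums_mult2[OF geometric_sums[of "1/2::real"], of "384 * (1 - ln (1 - norm z))"] by simp
    from sums_le[OF _ s[OF z] this] show "Re (F z) \<le> 768 * (1 - ln (1 - norm z))"
      using Re_cantor_herglotz_le[OF _ z] by (simp add: mult_left_mono)
    show "(1/2) ^ n * Re (cantor_herglotz (Suc n) z) \<le> Re (F z)" for n
      using sum_le_suminf[OF sums_summable[OF s[OF z]], of "{n}"] nonneg[OF z] sums_unique[OF s[OF z]] by simp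
  qed
qed

lemma exists_D_plus_H_meas_infinite:
  "\<exists>f\<in>A_minus_infty. (\<exists>c>0. \<forall>z\<in>ball 0 1. c \<le> norm (f z)) \<and> H_meas lam (D_plus f) = \<infinity>"
proof -
  obtain F where F: "F holomorphic_on ball 0 1"
    and nonneg: "\<And>z. norm z < 1 \<Longrightarrow> 0 \<le> Re (F z)"
    and upper: "\<And>z. norm z < 1 \<Longrightarrow> Re (F z) \<le> 768 * (1 - ln (1 - norm z))"
    and lower: "\<And>z n. norm z < 1 \<Longrightarrow> (1/2) ^ n * Re (cantor_herglotz (Suc n) z) \<le> Re (F z)"
    by (rule weighted_cantor_herglotz) blast
  define f where "f z = exp (F z)" for z
  have norm_f: "norm (f z) = exp (Re (F z))" for z by (simp add: f_def)
  have "f \<in> A_minus_infty"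
    unfolding A_minus_infty_def
  proof (intro CollectI conjI exI ballI)
    show "f holomorphic_on ball 0 1" unfolding f_def by (intro holomorphic_intros F)
    fix z :: complex assume "z \<in> ball 0 1"
    hence z: "norm z < 1" by simp
    have "norm (f z) \<le> exp (768 * (1 - ln (1 - norm z)))" using upper[OF z] by (simp add: norm_f)
    also have "\<dots> = exp 768 * (1 - norm z) powr (- 768)"
      using z by (simp add: powr_def exp_add[symmetric] algebra_simps)
    finally show "norm (f z) \<le> exp 768 * (1 - norm z) powr (- 768)" .
  qed
  moreover have "\<exists>c>0. \<forall>z\<in>ball 0 1. c \<le> norm (f z)"
    using nonneg by (intro exI[of _ 1]) (auto simp: norm_f)
  moreover have "H_meas lam (D_plus f) = \<infinity>"
  proof -
    have "cis ` cantor_map (Suc n) ` {0..<1} \<subseteq> D_plus f" for n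
    proof clarify
      fix x :: real assume x: "x \<in> {0..<1}"
      define \<theta> where "\<theta> = cantor_map (Suc n) x"
      have "0 \<le> \<theta>" "\<theta> \<le> 1" using cantor_map_bounds[of "Suc n" x] x by (auto simp: \<theta>_def)
      hence \<theta>: "\<theta> \<in> {0..<2*pi}" using pi_gt3 by auto
      \<comment> \<open>The rate deteriorates with \<open>n\<close>, but \<open>D_plus\<close> only
        asks for a positive liminf at each point separately.\<close>
      define c where "c = (1/2) ^ n * (1 / (4 * (1 + 2 * real (Suc n))\<^sup>2))"
      have c: "0 < c" by (simp add: c_def add_pos_nonneg)
      \<comment> \<open>The exponential cutoff is the scale below which the lower bound for
        \<open>cantor_herglotz\<close> holds.\<close>
      have "\<forall>\<^sub>F r in at_left (1::real). r \<in> {max 0 (1 - exp (- 2 * real (Suc n)))<..<1}"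
        by (intro eventually_at_left_real) auto
      hence "\<forall>\<^sub>F r in at_left 1. ereal c \<le> ereal (ln (norm (f (of_real r * cis \<theta>))) / \<bar>ln (1 - r)\<bar>)"
      proof eventually_elim
        case (elim r)
        define \<delta> where "\<delta> = 1 - r"
        have r: "r = 1 - \<delta>" by (simp add: \<delta>_def)
        have \<delta>: "0 < \<delta>" "\<delta> < exp (- 2 * real (Suc n))" using elim by (auto simp: \<delta>_def)
        have "ln \<delta> < - 2 * real (Suc n)" using \<delta> by (metis ln_exp ln_less_cancel_iff exp_gt_zero)
        hence l: "2 * real (Suc n) \<le> - ln \<delta>" by simp
        have "0 < r" "r < 1" using elim by (simp_all only: greaterThanLessThan_iff max_less_iff_conj)
        hence nr: "norm (of_real r * cis \<theta>) < 1" by (simp add: norm_mult)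
        have "c * - ln \<delta> = (1/2) ^ n * (- ln \<delta> / (4 * (1 + 2 * real (Suc n))\<^sup>2))" by (simp add: c_def)
        also have "\<dots> \<le> (1/2) ^ n * Re (cantor_herglotz (Suc n) (of_real r * cis \<theta>))"
          unfolding \<theta>_def r by (intro mult_left_mono Re_cantor_herglotz_ge x \<delta> l) auto
        also have "\<dots> \<le> Re (F (of_real r * cis \<theta>))" by (rule lower[OF nr])
        also have "\<dots> = ln (norm (f (of_real r * cis \<theta>)))" by (simp add: norm_f)
        finally have "c * - ln (1 - r) \<le> ln (norm (f (of_real r * cis \<theta>)))" by (simp add: \<delta>_def)
        moreover have "\<bar>ln (1 - r)\<bar> = - ln (1 - r)" "0 < - ln (1 - r)" using l by (auto simp: \<delta>_def)
        ultimately have "c \<le> ln (norm (f (of_real r * cis \<theta>))) / \<bar>ln (1 - r)\<bar>" by (simp only: pos_le_divide_eq)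
        thus ?case by simp
      qed
      hence "ereal c \<le> Liminf (at_left 1) (\<lambda>r. ereal (ln (norm (f (of_real r * cis \<theta>))) / \<bar>ln (1 - r)\<bar>))"
        by (rule Liminf_bounded)
      hence "0 < Liminf (at_left 1) (\<lambda>r. ereal (ln (norm (f (of_real r * cis \<theta>))) / \<bar>ln (1 - r)\<bar>))"
        using c by (metis ereal_less(2) less_le_trans)
      with \<theta> show "cis (cantor_map (Suc n) x) \<in> D_plus f"
        unfolding D_plus_def \<theta>_def[symmetric] by blast
    qed
    \<comment> \<open>One set \<open>D_plus f\<close> contains the Cantor sets of all indices, so
      its measure exceeds every bound.\<close>
    hence ge: "ennreal (real (Suc n) / 32) \<le> H_meas lam (D_plus f)" for n by (intro H_meas_cantor_ge) auto
    show ?thesis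
    proof (rule ccontr)
      assume "H_meas lam (D_plus f) \<noteq> \<infinity>"
      then obtain h where h: "H_meas lam (D_plus f) = ennreal h" "0 \<le> h" by (cases "H_meas lam (D_plus f)") auto
      obtain n where "32 * h < real n" using reals_Archimedean2 by blast
      hence "h < real (Suc n) / 32" by simp
      moreover have "real (Suc n) / 32 \<le> h" using ge[of n] h by (simp add: ennreal_le_iff)
      ultimately show False by simp
    qed
  qed
  ultimately show ?thesis by blast
qed

theorem theorem5:
  shows "(\<forall>f\<in>A_minus_infty. (\<exists>c>0. \<forall>z\<in>ball 0 1. c \<le> norm (f z)) \<longrightarrow>
            (\<exists>S :: nat \<Rightarrow> complex set. G_plus f = (\<Union>n. S n) \<and> (\<forall>n. H_meas lam (S n) < \<infinity>)))
       \<and> (\<exists>f\<in>A_minus_infty. (\<exists>c>0. \<forall>z\<in>ball 0 1. c \<le> norm (f z)) \<and> H_meas lam (D_plus f) = \<infinity>)"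
  using G_plus_decomposition exists_D_plus_H_meas_infinite by blast

end
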